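(* In the multistage inventory setting described in the context (horizon $T$, discount factor $\rho\in(0,1]$, costs $b_t>c_t>0$, $h_t\ge 0$, moment-based ambiguity sets $\mathcal M_t$, initial inventory $y_1$), suppose that $\mathcal I_t\subset\mathbb R_+$ for all $t=1,\dots,T$, and suppose there exists a nondecreasing sequence $x_1^*\le x_2^*\le\cdots\le x_T^*$ such that $y_1\le x_1^*$ and $x_t^*\in\hat\Gamma_t$ for $t=1,\dots,T$, where $\hat\Gamma_t=\arg\min_{x\in\mathbb R}\sup_{Q_t\in\mathcal M_t}\mathbb E_{Q_t}[\hat\Psi_t(x,D_t)]$. Then the base-stock policy $\pi$ given by $x_t=\max\{y_t,x_t^*\}$, $t=1,\dots,T$, is an optimal policy for the multistage-static formulation and a robust-w.p.1-optimal policy for the distributionally robust DP formulation, and it attains the value $$\sum_{t=1}^T\rho^{t-1}\hat\eta_t-c_1y_1+\sum_{t=1}^{T-1}\rho^t c_{t+1}\mu_t$$ under both formulations. Consequently, this base-stock policy is time consistent, and the multistage-static problem is weakly time consistent.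
   Context: Setting. $T\ge1$ is a finite horizon, $\rho\in(0,1]$ a discount factor, $y_1\in\mathbb R$ a given initial inventory level. For $t=1,\dots,T$: $c_t,b_t,h_t$ are ordering, backorder and holding costs with $b_t>c_t>0$, $h_t\ge0$; $\mathcal I_t=[\alpha_t,\beta_t]$ is a closed (possibly unbounded) interval; $\mu_t$ and $\sigma_t^2$ are a mean and a variance with $\mu_t\in[\alpha_t,\beta_t]$ and $\sigma_t^2\le(\beta_t-\mu_t)(\mu_t-\alpha_t)$ (with $0\cdot\infty=0$), so that the set $\mathcal M_t$ of probability measures $Q_t$ on $\mathbb R$ with support in $\mathcal I_t$, $\mathbb E_{Q_t}[D_t]=\mu_t$, $\mathbb E_{Q_t}[D_t^2]=\mu_t^2+\sigma_t^2$ is nonempty. Let $\mathcal M=\{Q_1\times\cdots\times Q_T: Q_t\in\mathcal M_t,\ t=1,\dots,T\}$ (product measures for the demand vector $(D_1,\dots,D_T)$). Write $d_{[t]}=(d_1,\dots,d_t)$ and $[a]_+=\max\{a,0\}$. Policies. $\Pi$ is the set of admissible policies $\pi=(x_1,\dots,x_T)$ of measurable functions $x_t=x_t^\pi:\mathbb R_+^{t-1}\to\mathbb R$ ($x_1$ a constant) with $x_t(d_{[t-1]})\ge y_t$ for all $d_{[t-1]}\in\mathbb R_+^{t-1}$ and all $t$, where $y_{t+1}=y_{t+1}^\pi(d_{[t]})=x_t(d_{[t-1]})-d_t$. A base-stock policy with constants $x_t^*$ is one with $x_t^\pi=\max\{y_t^\pi,x_t^*\}$ for all $t$. Costs. $\Psi_t(x,d)=b_t[d-x]_++h_t[x-d]_+$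 and $$Z^\pi(D_{[T]})=\sum_{t=1}^T\rho^{t-1}\big[c_t(x_t^\pi(D_{[t-1]})-y_t^\pi(D_{[t-1]}))+\Psi_t(x_t^\pi(D_{[t-1]}),D_t)\big].$$ With $c_{T+1}:=0$, $\hat\Psi_t(x,d)=(c_t-\rho c_{t+1})x+b_t[d-x]_++h_t[x-d]_+$, and $\hat\eta_t=\inf_{x\in\mathbb R}\sup_{Q_t\in\mathcal M_t}\mathbb E_{Q_t}[\hat\Psi_t(x,D_t)]$. Multistage-static formulation: $\inf_{\pi\in\Pi}\sup_{Q\in\mathcal M}\mathbb E_Q[Z^\pi]$; the value of $\pi$ under it is $\sup_{Q\in\mathcal M}\mathbb E_Q[Z^\pi]$, and $\pi$ is optimal if it attains the infimum. Distributionally robust DP formulation: $V_{T+1}\equiv0$, $$V_t(y)=\inf_{x\ge y}\Big\{c_t(x-y)+\sup_{Q_t\in\mathcal M_t}\mathbb E_{Q_t}[\Psi_t(x,D_t)+\rho V_{t+1}(x-D_t)]\Big\},$$ $\mathcal Y_t(y)$ is the set of minimizers $x\ge y$ in this problem, and the optimal value is $V_1(y_1)$. The value under this formulation of a policy in which $x_t=\pi_t(y_t)$ is a function of $y_t$ is $W_1(y_1)$, where $W_{T+1}\equiv0$ and $W_t(y)=c_t(\pi_t(y)-y)+\sup_{Q_t\in\mathcal M_t}\mathbb E_{Q_t}[\Psi_t(\pi_t(y),D_t)+\rho W_{t+1}(\pi_t(y)-D_t)]$. A policy $\pi\in\Pi$ is robust-w.p.1-optimal for the DP formulation if for every $Q\in\mathcal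 M$, with probability one under $Q$, $x_t^\pi(D_{[t-1]})\in\mathcal Y_t(y_t^\pi(D_{[t-1]}))$ for all $t=1,\dots,T$. Time consistency. A policy is time consistent if it is optimal for the multistage-static formulation and robust-w.p.1-optimal for the DP formulation. The multistage-static problem is weakly time consistent if at least one of its optimal policies is time consistent. *)

theory Defs
  imports "HOL-Probability.Probability"
begin

text \<open>
  Periods are \<open>1..T\<close>; period-indexed data are functions on \<open>nat\<close> of which only the values on
  \<open>{1..T}\<close> matter.  The endpoints of the demand intervals are extended reals, since the intervals
  may be unbounded.
\<close>

record inventory_model =
  horizon :: nat
  discount :: real
  init_inv :: real
  order_cost :: "nat \<Rightarrow> real"
  backorder_cost :: "nat \<Rightarrow> real"
  holding_cost :: "nat \<Rightarrow> real"
  demand_lower :: "nat \<Rightarrow> ereal"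
  demand_upper :: "nat \<Rightarrow> ereal"
  demand_mean :: "nat \<Rightarrow> real"
  demand_sd :: "nat \<Rightarrow> real"

text \<open>The product in the variance bound is taken in \<open>ereal\<close>, where \<open>0 * \<infinity> = 0\<close>.\<close>

definition valid_model :: "inventory_model \<Rightarrow> bool" where
  "valid_model P \<longleftrightarrow>
     1 \<le> horizon P \<and> 0 < discount P \<and> discount P \<le> 1 \<and>
     (\<forall>t\<in>{1..horizon P}.
        0 < order_cost P t \<and> order_cost P t < backorder_cost P t \<and> 0 \<le> holding_cost P t \<and>
        demand_lower P t \<le> ereal (demand_mean P t) \<and>
        ereal (demand_mean P t) \<le> demand_upper P t \<and>
        ereal ((demand_sd P t)\<^sup>2)
          \<le> (demand_upper P t - ereal (demand_mean P t)) *
            (ereal (demand_mean P t) - demand_lower P t))"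

definition demand_range :: "inventory_model \<Rightarrow> nat \<Rightarrow> real set" where
  "demand_range P t = {d. demand_lower P t \<le> ereal d \<and> ereal d \<le> demand_upper P t}"

definition ambiguity_set :: "inventory_model \<Rightarrow> nat \<Rightarrow> real measure set" where
  "ambiguity_set P t =
     {Q. prob_space Q \<and> sets Q = sets borel \<and>
         (AE d in Q. d \<in> demand_range P t) \<and>
         integrable Q (\<lambda>d. d) \<and> (\<integral>d. d \<partial>Q) = demand_mean P t \<and>
         integrable Q (\<lambda>d. d\<^sup>2) \<and> (\<integral>d. d\<^sup>2 \<partial>Q) = (demand_mean P t)\<^sup>2 + (demand_sd P t)\<^sup>2}"

definition joint_ambiguity_set :: "inventory_model \<Rightarrow> (nat \<Rightarrow> real) measure set" where
  "joint_ambiguity_set P =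
     {Pi\<^sub>M {1..horizon P} Q | Q. \<forall>t\<in>{1..horizon P}. Q t \<in> ambiguity_set P t}"

text \<open>
  Expectation with values in the extended reals, as the difference of the expectations of the
  positive and the negative part.  For valid models and nonnegative demands, the total cost of an
  admissible policy and the cost-to-go functions are nonnegative and may have infinite expectation,
  while \<open>adj_cost\<close> below is integrable under every measure of the ambiguity set; so \<open>\<infinity> - \<infinity>\<close>
  does not occur.  The nonnegative integral is invariant under almost-everywhere changes of the
  integrand without measurability conditions, so policies need only be measurable (and
  meaningful) on histories of nonnegative demands when demands are almost surely nonnegative.
\<close>

definition ext_expectation :: "'a measure \<Rightarrow> ('a \<Rightarrow> ereal) \<Rightarrow> ereal" where
  "ext_expectation M f =
     enn2ereal (\<integral>\<^sup>+ x. e2ennreal (f x) \<partial>M) - enn2ereal (\<integral>\<^sup>+ x. e2ennreal (- f x) \<partial>M)"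

text \<open>
  A policy \<open>x\<close> gives in period \<open>t\<close> the order-up-to level \<open>x t d\<close>, where \<open>d\<close> is a demand history
  of length \<open>t - 1\<close>, that is, an element of \<open>PiE {1..<t} (\<lambda>_. {0..})\<close>.  For a demand path \<open>d\<close>,
  this history is \<open>restrict d {1..<t}\<close>.
\<close>

type_synonym policy = "nat \<Rightarrow> (nat \<Rightarrow> real) \<Rightarrow> real"

definition inv_level :: "inventory_model \<Rightarrow> policy \<Rightarrow> nat \<Rightarrow> (nat \<Rightarrow> real) \<Rightarrow> real" where
  "inv_level P x t d =
     (if t \<le> 1 then init_inv P else x (t - 1) (restrict d {1..<t - 1}) - d (t - 1))"

definition admissible :: "inventory_model \<Rightarrow> policy set" where
  "admissible P =
     {x. \<forall>t\<in>{1..horizon P}.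
           x t \<in> borel_measurable (Pi\<^sub>M {1..<t} (\<lambda>_. restrict_space borel {0..})) \<and>
           (\<forall>d\<in>PiE {1..<t} (\<lambda>_. {0..}). inv_level P x t d \<le> x t d)}"

definition stage_cost :: "inventory_model \<Rightarrow> nat \<Rightarrow> real \<Rightarrow> real \<Rightarrow> real" where
  "stage_cost P t x d = backorder_cost P t * max (d - x) 0 + holding_cost P t * max (x - d) 0"

definition total_cost :: "inventory_model \<Rightarrow> policy \<Rightarrow> (nat \<Rightarrow> real) \<Rightarrow> real" where
  "total_cost P x d =
     (\<Sum>t=1..horizon P. discount P ^ (t - 1) *
        (order_cost P t * (x t (restrict d {1..<t}) - inv_level P x t d) +
         stage_cost P t (x t (restrict d {1..<t})) (d t)))"

definition static_value :: "inventory_model \<Rightarrow> policy \<Rightarrow> ereal" where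
  "static_value P x =
     (SUP Q\<in>joint_ambiguity_set P. ext_expectation Q (\<lambda>d. ereal (total_cost P x d)))"

definition static_optimal :: "inventory_model \<Rightarrow> policy \<Rightarrow> bool" where
  "static_optimal P x \<longleftrightarrow>
     x \<in> admissible P \<and> static_value P x = (INF x'\<in>admissible P. static_value P x')"

definition adj_cost :: "inventory_model \<Rightarrow> nat \<Rightarrow> real \<Rightarrow> real \<Rightarrow> real" where
  "adj_cost P t x d =
     (order_cost P t - discount P * (if t < horizon P then order_cost P (t + 1) else 0)) * x +
     backorder_cost P t * max (d - x) 0 + holding_cost P t * max (x - d) 0"

definition worst_adj_cost :: "inventory_model \<Rightarrow> nat \<Rightarrow> real \<Rightarrow> ereal" where
  "worst_adj_cost P t x =
     (SUP Q\<in>ambiguity_set P t. ext_expectation Q (\<lambda>d. ereal (adj_cost P t x d)))"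

definition eta_hat :: "inventory_model \<Rightarrow> nat \<Rightarrow> ereal" where
  "eta_hat P t = (INF x. worst_adj_cost P t x)"

definition Gamma_hat :: "inventory_model \<Rightarrow> nat \<Rightarrow> real set" where
  "Gamma_hat P t = {x. is_arg_min (worst_adj_cost P t) (\<lambda>_. True) x}"

text \<open>
  The objective of the dynamic programming problem of period \<open>t\<close> at inventory level \<open>y\<close> and
  order-up-to level \<open>x\<close>, where \<open>F\<close> is the cost-to-go function of period \<open>t + 1\<close>.
\<close>

definition dp_objective ::
  "inventory_model \<Rightarrow> (real \<Rightarrow> ereal) \<Rightarrow> nat \<Rightarrow> real \<Rightarrow> real \<Rightarrow> ereal" where
  "dp_objective P F t y x =
     ereal (order_cost P t * (x - y)) +
     (SUP Q\<in>ambiguity_set P t.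
        ext_expectation Q (\<lambda>d. ereal (stage_cost P t x d) + ereal (discount P) * F (x - d)))"

function dp_value :: "inventory_model \<Rightarrow> nat \<Rightarrow> real \<Rightarrow> ereal" where
  "dp_value P t =
     (if t \<le> horizon P
      then (\<lambda>y. INF x\<in>{y..}. dp_objective P (dp_value P (t + 1)) t y x)
      else (\<lambda>y. 0))"
  by pat_completeness auto
termination by (relation "Wellfounded.measure (\<lambda>(P, t). Suc (horizon P) - t)") auto

declare dp_value.simps [simp del]

definition dp_minimizers :: "inventory_model \<Rightarrow> nat \<Rightarrow> real \<Rightarrow> real set" where
  "dp_minimizers P t y =
     {x. is_arg_min (dp_objective P (dp_value P (t + 1)) t y) (\<lambda>x. y \<le> x) x}"

definition robust_wp1_optimal :: "inventory_model \<Rightarrow> policy \<Rightarrow> bool" where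
  "robust_wp1_optimal P x \<longleftrightarrow>
     x \<in> admissible P \<and>
     (\<forall>Q\<in>joint_ambiguity_set P. AE d in Q. \<forall>t\<in>{1..horizon P}.
        x t (restrict d {1..<t}) \<in> dp_minimizers P t (inv_level P x t d))"

text \<open>
  A decision rule \<open>p\<close> chooses the order-up-to level \<open>p t y\<close> as a function of the inventory level
  \<open>y\<close>; \<open>dp_rule_value\<close> is its value in the dynamic programming formulation, and \<open>rule_policy\<close> is
  the policy it induces.
\<close>

function dp_rule_value ::
  "inventory_model \<Rightarrow> (nat \<Rightarrow> real \<Rightarrow> real) \<Rightarrow> nat \<Rightarrow> real \<Rightarrow> ereal" where
  "dp_rule_value P p t =
     (if t \<le> horizon P
      then (\<lambda>y. dp_objective P (dp_rule_value P p (t + 1)) t y (p t y))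
      else (\<lambda>y. 0))"
  by pat_completeness auto
termination by (relation "Wellfounded.measure (\<lambda>(P, p, t). Suc (horizon P) - t)") auto

declare dp_rule_value.simps [simp del]

function rule_policy :: "inventory_model \<Rightarrow> (nat \<Rightarrow> real \<Rightarrow> real) \<Rightarrow> policy" where
  "rule_policy P p t d =
     p t (if t \<le> 1 then init_inv P
          else rule_policy P p (t - 1) (restrict d {1..<t - 1}) - d (t - 1))"
  by pat_completeness auto
termination by (relation "Wellfounded.measure (\<lambda>(P, p, t, d). t)") auto

declare rule_policy.simps [simp del]

lemma rule_policy_inv_level:
  "rule_policy P p t (restrict d {1..<t}) = p t (inv_level P (rule_policy P p) t d)"
proof (cases "t \<le> 1")
  case True
  then show ?thesis
    by (subst rule_policy.simps) (simp add: inv_level_def)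
next
  case False
  then have "{1..<t} \<inter> {1..<t - 1} = {1..<t - 1}" "t - 1 \<in> {1..<t}" by auto
  with False show ?thesis
    by (subst rule_policy.simps) (simp only: inv_level_def restrict_restrict restrict_apply if_False if_True)
qed

definition base_stock_rule :: "(nat \<Rightarrow> real) \<Rightarrow> nat \<Rightarrow> real \<Rightarrow> real" where
  "base_stock_rule s t y = max y (s t)"

definition base_stock_policy :: "inventory_model \<Rightarrow> (nat \<Rightarrow> real) \<Rightarrow> policy" where
  "base_stock_policy P s = rule_policy P (base_stock_rule s)"

definition time_consistent :: "inventory_model \<Rightarrow> policy \<Rightarrow> bool" where
  "time_consistent P x \<longleftrightarrow> static_optimal P x \<and> robust_wp1_optimal P x"

definition weakly_time_consistent :: "inventory_model \<Rightarrow> bool" where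
  "weakly_time_consistent P \<longleftrightarrow> (\<exists>x. static_optimal P x \<and> time_consistent P x)"

end

theory Submission
  imports Defs
begin

text \<open>
  Charging the purchase of the leftover inventory of a period to that period turns the total cost
  into a sum of one-period costs \<open>adj_cost\<close>, up to terms that do not depend on the policy.  The
  static value of a policy is bounded below by a one-dimensional minimax argument: in each period
  there is a single distribution \<open>Q\<^sub>t\<close> under which every order-up-to level costs at least
  \<open>eta_hat\<close> up to \<open>\<epsilon>\<close>, and under the product of these the order-up-to level of a period is
  independent of its demand.  In the dynamic program, \<open>V\<^sub>t(y) \<ge> K\<^sub>t - c\<^sub>t y\<close> for all \<open>y\<close>, with equality
  for \<open>y \<le> s t\<close>.  Both bounds are attained by the base-stock policy, as demands are nonnegative and
  \<open>s\<close> is nondecreasing, so that the inventory never exceeds the base-stock level.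
\<close>

subsection \<open>Extended expectations and mixtures\<close>

text \<open>A lower bound for the static value must hold against levels chosen from the history, so
  one distribution per period has to be bad for all levels at once: infimum and supremum must be
  exchanged. The ambiguity set is convex but need not be compact, so compactness is taken from the
  levels: the expected cost is convex in the level, and coercive as long as its slope c_t - rho
  c_{t+1} + h_t at infinity is positive. This slope may also be zero or negative; finiteness of
  \<open>eta_hat\<close> excludes the negative case, and the zero case has an argument of its own. A
  worst distribution need not exist, whence the epsilon. The second obstacle is integrability: the
  decoupled one-period costs have no sign, and an admissible policy may have infinite expected cost.
  The original form of the cost, a sum of nonnegative terms, settles which case holds.\<close>

lemma ext_expectation_integrable:
  assumes "integrable M f"
  shows "ext_expectation M (\<lambda>x. ereal (f x)) = ereal (\<integral>x. f x \<partial>M)"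
proof -
  have fin: "(\<integral>\<^sup>+x. ennreal (f x) \<partial>M) < \<infinity>" "(\<integral>\<^sup>+x. ennreal (- f x) \<partial>M) < \<infinity>"
    using assms by (simp_all add: real_integrable_def less_top)
  have *: "enn2ereal a - enn2ereal b = ereal (enn2real a - enn2real b)"
    if "a < \<infinity>" "b < \<infinity>" for a b
    using that by (cases a; cases b) (auto simp: enn2ereal_ennreal)
  show ?thesis
    unfolding ext_expectation_def
    by (simp add: *[OF fin] real_lebesgue_integral_def[OF assms])
qed

text \<open>Nonnegative integrals are monotone for arbitrary functions, so this applies to the value
  functions of the dynamic program, whose measurability is never established.\<close>

lemma ext_expectation_mono_AE:
  assumes "AE x in M. f x \<le> g x"
  shows "ext_expectation M f \<le> ext_expectation M g"
  unfolding ext_expectation_def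
proof (rule ereal_minus_mono)
  show "enn2ereal (\<integral>\<^sup>+ x. e2ennreal (f x) \<partial>M) \<le> enn2ereal (\<integral>\<^sup>+ x. e2ennreal (g x) \<partial>M)"
    using assms by (auto intro!: nn_integral_mono_AE e2ennreal_mono simp: less_eq_ennreal.rep_eq[symmetric])
  show "enn2ereal (\<integral>\<^sup>+ x. e2ennreal (- g x) \<partial>M) \<le> enn2ereal (\<integral>\<^sup>+ x. e2ennreal (- f x) \<partial>M)"
    using assms by (auto intro!: nn_integral_mono_AE e2ennreal_mono simp: less_eq_ennreal.rep_eq[symmetric])
qed

lemma ext_expectation_cong_AE:
  assumes "AE x in M. f x = g x"
  shows "ext_expectation M f = ext_expectation M g"
  using assms by (intro antisym ext_expectation_mono_AE) auto

text \<open>The mixture is a two-stage experiment: a Bernoulli variable selects the distribution to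
  sample from. Means, moments and null sets all follow from the formula for nonnegative
  integrals.\<close>

lemma mixture_measure:
  fixes p :: real
  assumes p: "0 \<le> p" "p \<le> 1"
    and Q1: "prob_space Q1" "sets Q1 = sets borel" and Q2: "prob_space Q2" "sets Q2 = sets borel"
  obtains Q :: "'a::topological_space measure" where
    "prob_space Q" "sets Q = sets borel"
    "\<forall>f\<in>borel_measurable borel.
      (\<integral>\<^sup>+x. f x \<partial>Q) = ennreal p * (\<integral>\<^sup>+x. f x \<partial>Q1) + ennreal (1 - p) * (\<integral>\<^sup>+x. f x \<partial>Q2)"
proof
  let ?B = "measure_pmf (bernoulli_pmf p)"
  let ?N = "\<lambda>b. if b then Q1 else Q2"
  have N: "?N \<in> measurable ?B (subprob_algebra borel)"
    using Q1 Q2 by (auto simp: space_subprob_algebra prob_space_imp_subprob_space)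
  show "prob_space (?B \<bind> ?N)"
    by (rule measure_pmf.prob_space_bind[OF _ N]) (use Q1 Q2 in auto)
  show "sets (?B \<bind> ?N) = sets borel"
    by (rule sets_bind) (use Q1 Q2 in auto)
  have "(\<integral>\<^sup>+x. f x \<partial>(?B \<bind> ?N)) = ennreal p * (\<integral>\<^sup>+x. f x \<partial>Q1) + ennreal (1 - p) * (\<integral>\<^sup>+x. f x \<partial>Q2)"
    if "f \<in> borel_measurable borel" for f
    using p by (subst nn_integral_bind[OF that N])
      (simp add: mult.commute)
  then show "\<forall>f\<in>borel_measurable borel. (\<integral>\<^sup>+x. f x \<partial>(?B \<bind> ?N)) =
      ennreal p * (\<integral>\<^sup>+x. f x \<partial>Q1) + ennreal (1 - p) * (\<integral>\<^sup>+x. f x \<partial>Q2)" by blast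
qed

lemma mixture_integral:
  fixes p :: real and f :: "'a::topological_space \<Rightarrow> real"
  assumes p: "0 \<le> p" "p \<le> 1"
    and sets: "sets Q1 = sets borel" "sets Q2 = sets borel" "sets Q = sets borel"
    and mix: "\<forall>f\<in>borel_measurable borel.
      (\<integral>\<^sup>+x. f x \<partial>Q) = ennreal p * (\<integral>\<^sup>+x. f x \<partial>Q1) + ennreal (1 - p) * (\<integral>\<^sup>+x. f x \<partial>Q2)"
    and f: "integrable Q1 f" "integrable Q2 f"
  shows "integrable Q f"
    and "(\<integral>x. f x \<partial>Q) = p * (\<integral>x. f x \<partial>Q1) + (1 - p) * (\<integral>x. f x \<partial>Q2)"
proof -
  have [measurable]: "f \<in> borel_measurable borel"
    using borel_measurable_integrable[OF f(1)] measurable_cong_sets[OF sets(1) refl] by blast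
  have m: "f \<in> borel_measurable Q"
    by (simp add: measurable_cong_sets[OF sets(3) refl])
  have e: "(\<integral>\<^sup>+x. ennreal (g x) \<partial>Q) < \<infinity> \<and> enn2real (\<integral>\<^sup>+x. ennreal (g x) \<partial>Q) =
      p * enn2real (\<integral>\<^sup>+x. ennreal (g x) \<partial>Q1) + (1 - p) * enn2real (\<integral>\<^sup>+x. ennreal (g x) \<partial>Q2)"
    if g: "integrable Q1 g" "integrable Q2 g" and [measurable]: "g \<in> borel_measurable borel" for g
  proof -
    obtain a b where "0 \<le> a" "(\<integral>\<^sup>+x. ennreal (g x) \<partial>Q1) = ennreal a"
      "0 \<le> b" "(\<integral>\<^sup>+x. ennreal (g x) \<partial>Q2) = ennreal b"
      using g by (metis ennreal_cases infinity_ennreal_def real_integrable_def)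
    then show ?thesis
      using p by (subst mix[rule_format], measurable, subst mix[rule_format], measurable)
        (simp add: ennreal_mult[symmetric] ennreal_plus[symmetric] ennreal_lessI del: ennreal_plus)
  qed
  show int: "integrable Q f"
    using e[OF f] e[of "\<lambda>x. - f x"] f m by (auto simp: real_integrable_def)
  show "(\<integral>x. f x \<partial>Q) = p * (\<integral>x. f x \<partial>Q1) + (1 - p) * (\<integral>x. f x \<partial>Q2)"
    using e[OF f] e[of "\<lambda>x. - f x"] f
    by (simp add: real_lebesgue_integral_def int algebra_simps)
qed

lemma mixture_AE:
  fixes p :: real
  assumes sets: "sets Q1 = sets borel" "sets Q2 = sets borel" "sets Q = sets borel"
    and mix: "\<forall>f\<in>borel_measurable borel.
      (\<integral>\<^sup>+x. f x \<partial>Q) = ennreal p * (\<integral>\<^sup>+x. f x \<partial>Q1) + ennreal (1 - p) * (\<integral>\<^sup>+x. f x \<partial>Q2)"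
    and A[measurable]: "A \<in> sets borel" and "AE x in Q1. x \<in> A" "AE x in Q2. x \<in> A"
  shows "AE x in Q. x \<in> A"
proof -
  have ae: "(AE x in M. x \<in> A) \<longleftrightarrow> (\<integral>\<^sup>+x. indicator (- A) x \<partial>M) = 0" if "sets M = sets borel" for M
  proof -
    have A': "- A \<in> sets M" using A that by auto
    moreover have "{x \<in> space M. x \<notin> A} = - A"
      using that sets_eq_imp_space_eq[OF that] by auto
    ultimately show ?thesis
      by (auto simp: AE_iff_null null_sets_def nn_integral_indicator[OF A'])
  qed
  show ?thesis
    using assms(6,7) by (simp add: ae sets mix del: nn_integral_indicator)
qed

subsection \<open>A one-dimensional minimax theorem\<close>

text \<open>Separation in the plane: the pairs dominating some \<open>(f x, g x)\<close> form a
  convex set that misses the quadrant below \<open>(c, c)\<close>. The normal of a separating line,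
  scaled to sum 1, gives the weights.\<close>

lemma two_convex_functions_minimax:
  fixes f g :: "real \<Rightarrow> real"
  assumes f: "convex_on UNIV f" and g: "convex_on UNIV g"
    and max: "\<And>x. c < f x \<or> c < g x"
  obtains p where "0 \<le> p" "p \<le> 1" "\<And>x. c \<le> p * f x + (1 - p) * g x"
proof -
  let ?A = "{z. \<exists>x. f x \<le> fst z \<and> g x \<le> snd z} :: (real \<times> real) set"
  let ?B = "{..c} \<times> {..c}"
  have "convex ?A"
  proof (rule convexI, clarsimp)
    fix u v x a b a' b' y :: real
    assume *: "0 \<le> u" "0 \<le> v" "u + v = 1" "f x \<le> a" "g x \<le> b" "f y \<le> a'" "g y \<le> b'"
    have "f (u * x + v * y) \<le> u * a + v * a'"
      using convex_onD[OF f, of v x y] * mult_left_mono[of "f x" a u] mult_left_mono[of "f y" a' v]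
      by (simp add: eq_diff_eq[symmetric])
    moreover have "g (u * x + v * y) \<le> u * b + v * b'"
      using convex_onD[OF g, of v x y] * mult_left_mono[of "g x" b u] mult_left_mono[of "g y" b' v]
      by (simp add: eq_diff_eq[symmetric])
    ultimately show "\<exists>x. f x \<le> u * a + v * a' \<and> g x \<le> u * b + v * b'" by blast
  qed
  moreover have "convex ?B" by (intro convex_Times) auto
  moreover have "?A \<noteq> {}" by (auto intro: exI[of _ "f 0"] exI[of _ "g 0"])
  moreover have "?B \<noteq> {}" by auto
  moreover have "?A \<inter> ?B = {}"
    using max by (auto simp: not_le) (meson not_le order.trans)
  ultimately obtain a b where ab: "a \<noteq> 0" "\<forall>z\<in>?B. inner a z \<le> b" "\<forall>z\<in>?A. b \<le> inner a z"
    using separating_hyperplane_sets[of ?B ?A] by blast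
  obtain m n where a: "a = (m, n)" by (cases a)
  have A: "b \<le> m * u + n * v" if "f x \<le> u" "g x \<le> v" for u v x
    using ab(3) that a by (force simp: inner_prod_def)
  have B: "m * c + n * c \<le> b"
    using ab(2) a by (auto simp: inner_prod_def)
  have B1: "m * (c - k) + n * (c - l) \<le> b" if "0 \<le> k" "0 \<le> l" for k l
    using ab(2) a that by (auto simp: inner_prod_def)
  \<comment> \<open>The quadrant is unbounded downwards in each coordinate; were a component of the
    normal negative, the linear functional would be unbounded above on it. The shift below is chosen
    to exceed \<open>b\<close> by at least 1.\<close>
  have m: "0 \<le> m"
  proof (rule ccontr)
    assume "\<not> 0 \<le> m"
    then have k: "0 \<le> (\<bar>b - m * c - n * c\<bar> + 1) / (- m)"
      "m * ((\<bar>b - m * c - n * c\<bar> + 1) / (- m)) = - (\<bar>b - m * c - n * c\<bar> + 1)"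
      by (auto simp: divide_nonneg_neg)
    show False
      using B1[of "(\<bar>b - m * c - n * c\<bar> + 1) / (- m)" 0, OF k(1) order_refl] k(2)
      by (simp only: right_diff_distrib mult_zero_right)
  qed
  have n: "0 \<le> n"
  proof (rule ccontr)
    assume "\<not> 0 \<le> n"
    then have k: "0 \<le> (\<bar>b - m * c - n * c\<bar> + 1) / (- n)"
      "n * ((\<bar>b - m * c - n * c\<bar> + 1) / (- n)) = - (\<bar>b - m * c - n * c\<bar> + 1)"
      by (auto simp: divide_nonneg_neg)
    show False
      using B1[of 0 "(\<bar>b - m * c - n * c\<bar> + 1) / (- n)", OF order_refl k(1)] k(2)
      by (simp only: right_diff_distrib mult_zero_right)
  qed
  have pos: "0 < m + n" using m n a ab(1) by (cases "m = 0") (auto simp: zero_prod_def)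
  show ?thesis
  proof
    show "0 \<le> m / (m + n)" "m / (m + n) \<le> 1" using m n pos by auto
    fix x
    have "(m + n) * c \<le> m * f x + n * g x"
      using A[of x "f x" "g x"] B by (simp add: algebra_simps)
    moreover have "1 - m / (m + n) = n / (m + n)" using pos by (simp add: field_simps)
    ultimately show "c \<le> m / (m + n) * f x + (1 - m / (m + n)) * g x"
      using pos by (simp add: add_divide_distrib[symmetric] pos_le_divide_eq mult.commute)
  qed
qed

lemma convex_sublevel:
  assumes "convex_on UNIV f"
  shows "convex {x. f x \<le> (c::real)}"
proof (rule convexI, clarsimp)
  fix x y u v
  assume *: "f x \<le> c" "f y \<le> c" "0 \<le> u" "0 \<le> v" "u + v = (1::real)"
  then have "u * f x + v * f y \<le> c" by (simp add: convex_bound_le)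
  with convex_onD[OF assms, of v x y] * show "f (u *\<^sub>R x + v *\<^sub>R y) \<le> c"
    by (simp add: eq_diff_eq[symmetric])
qed

text \<open>By the two-function case the sublevel sets \<open>{x. f q x \<le> c}\<close> meet pairwise; being compact
  intervals, they would have a common point (Helly) if none were empty.\<close>

lemma convex_minimax:
  fixes f :: "'a \<Rightarrow> real \<Rightarrow> real"
  assumes ne: "S \<noteq> {}"
    and conv: "\<And>q. q \<in> S \<Longrightarrow> convex_on UNIV (f q)"
    and mix: "\<And>q q' p. q \<in> S \<Longrightarrow> q' \<in> S \<Longrightarrow> 0 \<le> p \<Longrightarrow> p \<le> 1 \<Longrightarrow>
      \<exists>r\<in>S. \<forall>x. f r x = p * f q x + (1 - p) * f q' x"
    and bdd: "\<And>q. q \<in> S \<Longrightarrow> bounded {x. f q x \<le> c}"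
    and large: "\<And>x. \<exists>q\<in>S. c < f q x"
  shows "\<exists>q\<in>S. \<forall>x. c \<le> f q x"
proof (rule ccontr)
  assume contr: "\<not> ?thesis"
  define I where "I q = {x. f q x \<le> c}" for q
  have meet: "I q \<inter> I q' \<noteq> {}" if q: "q \<in> S" "q' \<in> S" for q q'
  proof
    assume "I q \<inter> I q' = {}"
    \<comment> \<open>The maximum of the two functions exceeds \<open>c\<close> everywhere, so some
      mixture of them, again a member of the family, is at least \<open>c\<close>
      throughout.\<close>
    then have "\<And>x. c < f q x \<or> c < f q' x" by (auto simp: I_def disjoint_iff not_le)
    from two_convex_functions_minimax[OF conv[OF q(1)] conv[OF q(2)] this]
    obtain p where "0 \<le> p" "p \<le> 1" "\<And>x. c \<le> p * f q x + (1 - p) * f q' x" by blast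
    with mix[OF q, of p] contr show False by metis
  qed
  have "\<exists>l r. I q = {l..r}" if q: "q \<in> S" for q
  proof -
    have "continuous_on UNIV (f q)" by (intro convex_on_continuous conv q) auto
    then have "closed (I q)"
      unfolding I_def by (intro closed_Collect_le) auto
    moreover have "connected (I q)"
      unfolding I_def using convex_sublevel[OF conv[OF q]] by (rule convex_connected)
    ultimately show ?thesis
      using connected_compact_interval_1[of "I q"] bdd[OF q]
      by (auto simp: compact_eq_bounded_closed I_def[symmetric])
  qed
  then obtain l r where lr: "\<And>q. q \<in> S \<Longrightarrow> I q = {l q..r q}" by metis
  have le: "l q \<le> r q'" if "q \<in> S" "q' \<in> S" for q q'
    using meet[OF that] lr that by auto
  \<comment> \<open>Every left end lies below every right end, so the supremum of the left ends
    belongs to all intervals.\<close>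
  define z where "z = (SUP q\<in>S. l q)"
  have "bdd_above (l ` S)" using le ne by (meson bdd_aboveI2 ex_in_conv)
  then have "z \<in> I q" if "q \<in> S" for q
    using that le ne by (auto simp: lr z_def intro!: cSUP_upper cSUP_least)
  then show False
    using large[of z] by (auto simp: I_def not_le[symmetric])
qed

subsection \<open>Products and demand paths\<close>

text \<open>Fubini with coordinate \<open>i\<close> innermost. It replaces conditioning on the
  history: the other demands are frozen while the demand of one period is averaged.\<close>

lemma PiM_integral_ge:
  fixes h :: "('i \<Rightarrow> 'a) \<Rightarrow> real"
  assumes M: "\<And>j. j \<in> I \<Longrightarrow> prob_space (M j)" "prob_space (M i)"
    and h: "integrable (Pi\<^sub>M (insert i I) M) h"
    and ge: "\<And>X. X \<in> space (Pi\<^sub>M I M) \<Longrightarrow> k \<le> (\<integral>y. h (X(i := y)) \<partial>M i)"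
  shows "k \<le> (\<integral>X. h X \<partial>Pi\<^sub>M (insert i I) M)"
proof -
  interpret Mi: prob_space "M i" by fact
  interpret I: prob_space "Pi\<^sub>M I M" by (intro prob_space_PiM M)
  interpret pair_sigma_finite "M i" "Pi\<^sub>M I M" ..
  let ?up = "\<lambda>(x, X). X(i := x)"
  have up: "?up \<in> measurable (M i \<Otimes>\<^sub>M Pi\<^sub>M I M) (Pi\<^sub>M (insert i I) M)"
    by (simp add: measurable_fun_upd)
  have eq: "distr (M i \<Otimes>\<^sub>M Pi\<^sub>M I M) (Pi\<^sub>M (insert i I) M) ?up = Pi\<^sub>M (insert i I) M"
    by (rule distr_pair_PiM_eq_PiM) (use M in auto)
  have "integrable (distr (M i \<Otimes>\<^sub>M Pi\<^sub>M I M) (Pi\<^sub>M (insert i I) M) ?up) h"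
    unfolding eq by (rule h)
  from integrable_distr[OF up this] have int: "integrable (M i \<Otimes>\<^sub>M Pi\<^sub>M I M) (\<lambda>(x, X). h (X(i := x)))"
    by (simp add: case_prod_unfold)
  have "k = (\<integral>X. k \<partial>Pi\<^sub>M I M)" by (simp add: I.prob_space)
  also have "\<dots> \<le> (\<integral>X. (\<integral>y. h (X(i := y)) \<partial>M i) \<partial>Pi\<^sub>M I M)"
    by (intro integral_mono integrable_snd[OF int] ge) auto
  also have "\<dots> = (\<integral>z. (\<lambda>(x, X). h (X(i := x))) z \<partial>(M i \<Otimes>\<^sub>M Pi\<^sub>M I M))"
    by (rule integral_snd[OF int])
  also have "\<dots> = (\<integral>X. h X \<partial>distr (M i \<Otimes>\<^sub>M Pi\<^sub>M I M) (Pi\<^sub>M (insert i I) M) ?up)"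
    using h by (subst integral_distr[OF up]) (auto simp: case_prod_unfold)
  finally show ?thesis by (simp add: eq)
qed

lemma inv_level_Suc: "1 \<le> t \<Longrightarrow> inv_level P x (Suc t) d = x t (restrict d {1..<t}) - d t"
  by (simp add: inv_level_def)

lemma inv_level_1: "inv_level P x 1 d = init_inv P"
  by (simp add: inv_level_def)

lemma inv_level_restrict:
  assumes "{1..<t} \<subseteq> A"
  shows "inv_level P x t (restrict d A) = inv_level P x t d"
proof (cases "t \<le> 1")
  case False
  then have "t - 1 \<in> {1..<t}" "{1..<t - 1} \<subseteq> {1..<t}" by auto
  with assms have "t - 1 \<in> A" "A \<inter> {1..<t - 1} = {1..<t - 1}" by blast+
  then have "restrict (restrict d A) {1..<t - 1} = restrict d {1..<t - 1}" "t - 1 \<in> A"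
    by (simp_all only: restrict_restrict)
  with False show ?thesis by (simp only: inv_level_def restrict_apply if_True if_False)
qed (simp add: inv_level_def)

text \<open>Demand paths will be replaced by truncated ones that are \<open>undefined\<close>
  outside the horizon; the cost must not see these values.\<close>

lemma total_cost_restrict: "total_cost P x (restrict d {1..horizon P}) = total_cost P x d"
  unfolding total_cost_def
proof (rule sum.cong)
  fix t assume t: "t \<in> {1..horizon P}"
  then have sub: "{1..<t} \<subseteq> {1..horizon P}" by auto
  then have "restrict (restrict d {1..horizon P}) {1..<t} = restrict d {1..<t}"
    by (simp only: restrict_restrict Int_absorb1)
  with t show "discount P ^ (t - 1) * (order_cost P t * (x t (restrict (restrict d {1..horizon P}) {1..<t}) -
      inv_level P x t (restrict d {1..horizon P})) +
      stage_cost P t (x t (restrict (restrict d {1..horizon P}) {1..<t})) (restrict d {1..horizon P} t)) =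
    discount P ^ (t - 1) * (order_cost P t * (x t (restrict d {1..<t}) - inv_level P x t d) +
      stage_cost P t (x t (restrict d {1..<t})) (d t))"
    by (simp only: inv_level_restrict[OF sub] restrict_apply if_True)
qed simp

subsection \<open>One-period costs\<close>

locale inventory =
  fixes P :: inventory_model
  assumes valid: "valid_model P"
    and demand_range_nonneg: "\<And>t. t \<in> {1..horizon P} \<Longrightarrow> demand_range P t \<subseteq> {0..}"
begin

text \<open>The unit cost \<open>c\<^sub>t\<close> with the convention \<open>c\<^sub>T\<^sub>+\<^sub>1 = 0\<close>.\<close>

definition unit_cost :: "nat \<Rightarrow> real" where
  "unit_cost t = (if t \<le> horizon P then order_cost P t else 0)"

text \<open>The linear coefficient of \<open>adj_cost\<close>: the price of a unit now, less the
  discounted price of the unit it saves in the next period. It may be negative.\<close>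

definition net_cost :: "nat \<Rightarrow> real" where
  "net_cost t = unit_cost t - discount P * unit_cost (t + 1)"

definition expected_adj_cost :: "nat \<Rightarrow> real measure \<Rightarrow> real \<Rightarrow> real" where
  "expected_adj_cost t Q x = (\<integral>d. adj_cost P t x d \<partial>Q)"

lemma discount: "0 < discount P" "discount P \<le> 1"
  using valid by (auto simp: valid_model_def)

lemma horizon_pos: "1 \<le> horizon P"
  using valid by (auto simp: valid_model_def)

lemma unit_cost_nonneg: "1 \<le> t \<Longrightarrow> 0 \<le> unit_cost t"
proof -
  have "\<forall>t\<in>{1..horizon P}. 0 < order_cost P t" using valid by (simp add: valid_model_def)
  then show "1 \<le> t \<Longrightarrow> 0 \<le> unit_cost t" by (simp add: unit_cost_def less_imp_le)
qed

lemma adj_cost_eq: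
  "t \<le> horizon P \<Longrightarrow> adj_cost P t x d = net_cost t * x + stage_cost P t x d"
  by (simp add: adj_cost_def net_cost_def unit_cost_def stage_cost_def)

context
  fixes t assumes t: "t \<in> {1..horizon P}"
begin

lemma costs: "0 < order_cost P t" "order_cost P t < backorder_cost P t" "0 \<le> holding_cost P t"
  using t valid by (auto simp: valid_model_def)

lemma stage_cost_nonneg: "0 \<le> stage_cost P t x d"
  using costs by (auto simp: stage_cost_def)

text \<open>Makes the slope of the expected cost at minus infinity,
  \<open>net_cost t - backorder_cost P t\<close>, negative.\<close>

lemma net_cost_less: "net_cost t < backorder_cost P t"
  using t costs discount unit_cost_nonneg[of "t + 1"]
  by (smt (verit) net_cost_def unit_cost_def atLeastAtMost_iff le_add2 mult_nonneg_nonneg)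

lemma ambiguity_setD:
  assumes "Q \<in> ambiguity_set P t"
  shows "prob_space Q" "sets Q = sets borel" "AE d in Q. 0 \<le> d"
    "integrable Q (\<lambda>d. d)" "(\<integral>d. d \<partial>Q) = demand_mean P t"
    "integrable Q (\<lambda>d. d\<^sup>2)" "(\<integral>d. d\<^sup>2 \<partial>Q) = (demand_mean P t)\<^sup>2 + (demand_sd P t)\<^sup>2"
  using assms demand_range_nonneg[OF t] by (auto simp: ambiguity_set_def)

lemma demand_range_borel: "demand_range P t \<in> sets borel"
  unfolding demand_range_def by measurable

text \<open>Support and moment conditions are preserved by mixing. The integral formula is passed on
  because the minimax argument needs the expected costs to mix as well.\<close>

lemma convex_ambiguity_set:
  assumes "Q \<in> ambiguity_set P t" "Q' \<in> ambiguity_set P t" "0 \<le> p" "p \<le> 1"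
  obtains R where "R \<in> ambiguity_set P t"
    "\<And>f :: real \<Rightarrow> real. integrable Q f \<Longrightarrow> integrable Q' f \<Longrightarrow>
       (\<integral>x. f x \<partial>R) = p * (\<integral>x. f x \<partial>Q) + (1 - p) * (\<integral>x. f x \<partial>Q')"
proof -
  note Q = ambiguity_setD[OF assms(1)] and Q' = ambiguity_setD[OF assms(2)]
  obtain R where R: "prob_space R" "sets R = sets borel"
    "\<forall>f\<in>borel_measurable borel.
      (\<integral>\<^sup>+x. f x \<partial>R) = ennreal p * (\<integral>\<^sup>+x. f x \<partial>Q) + ennreal (1 - p) * (\<integral>\<^sup>+x. f x \<partial>Q')"
    using mixture_measure[OF assms(3,4) Q(1,2) Q'(1,2)] by blast
  note int = mixture_integral[OF assms(3,4) Q(2) Q'(2) R(2,3)]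
  have "AE d in R. d \<in> demand_range P t"
    using assms(1,2) by (intro mixture_AE[OF Q(2) Q'(2) R(2,3) demand_range_borel])
      (auto simp: ambiguity_set_def)
  then have "R \<in> ambiguity_set P t"
    using R(1,2) int[OF Q(4) Q'(4)] int[OF Q(6) Q'(6)] Q(5,7) Q'(5,7)
    by (simp add: ambiguity_set_def algebra_simps)
  with int(2) that show ?thesis by blast
qed

text \<open>Witnesses are a point mass at the mean if the variance is zero, and otherwise a
  two-point distribution one of whose atoms is the lower end of the demand range.\<close>

lemma ambiguity_set_nonempty: "ambiguity_set P t \<noteq> {}"
proof -
  define m v where "m = demand_mean P t" and "v = (demand_sd P t)\<^sup>2"
  have mean: "demand_lower P t \<le> ereal m" "ereal m \<le> demand_upper P t"
    and var: "ereal v \<le> (demand_upper P t - ereal m) * (ereal m - demand_lower P t)"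
    using valid t by (auto simp: valid_model_def m_def v_def)
  have "0 \<le> v" by (simp add: v_def)
  have ret: "prob_space (return borel a)" "sets (return borel a) = sets borel"
    "(\<integral>x. f x \<partial>return borel a) = f a" "integrable (return borel a) f"
    "(AE x in return borel a. x \<in> demand_range P t) \<longleftrightarrow> a \<in> demand_range P t"
    if "f \<in> borel_measurable borel" for a :: real and f :: "real \<Rightarrow> real"
    using that demand_range_borel
    by (auto simp: prob_space_return integral_return nn_integral_return AE_return integrable_iff_bounded)
  have meas: "(\<lambda>x::real. x) \<in> borel_measurable borel" "(\<lambda>x::real. x\<^sup>2) \<in> borel_measurable borel"
    by measurable
  show ?thesis
  proof (cases "v = 0")
    case True
    have "m \<in> demand_range P t" using mean by (simp add: demand_range_def)
    then have "return borel m \<in> ambiguity_set P t"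
      using ret[OF meas(1), of m] ret(3,4)[OF meas(2), of m] True
      unfolding ambiguity_set_def m_def[symmetric] v_def[symmetric] by simp
    then show ?thesis by blast
  next
    case False
    \<comment> \<open>The lower end is finite, as otherwise the range would contain a negative
      number.\<close>
    obtain a where a: "demand_lower P t = ereal a"
    proof (cases "demand_lower P t")
      case (real r)
      then show ?thesis by (rule that)
    next
      case PInf
      then show ?thesis using mean by simp
    next
      case MInf
      have "ereal (min m (-1)) \<le> ereal m" by simp
      from order_trans[OF this mean(2)] MInf have "min m (-1) \<in> demand_range P t"
        by (simp add: demand_range_def)
      with demand_range_nonneg[OF t] show ?thesis by auto
    qed
    have "a \<noteq> m"
    proof
      assume "a = m"
      with var a have "v \<le> 0" by (simp add: zero_ereal_def[symmetric])
      with False \<open>0 \<le> v\<close> show False by simp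
    qed
    with mean(1) a have am: "a < m" by simp
    \<comment> \<open>Two atoms a < b with mean m have variance (m - a)(b - m); this
      \<open>b\<close> makes it \<open>v\<close>, and the variance bound of the model says that
      \<open>b\<close> is in the range. The weight \<open>p\<close> of \<open>b\<close> below is
      dictated by the mean.\<close>
    define b where "b = m + v / (m - a)"
    have b: "m < b" using am False \<open>0 \<le> v\<close> by (auto simp: b_def)
    have "ereal b \<le> demand_upper P t"
    proof (cases "demand_upper P t")
      case (real u)
      then have "v \<le> (u - m) * (m - a)" using var a by simp
      then have "v / (m - a) \<le> u - m" using am by (simp add: pos_divide_le_eq)
      then show ?thesis using real by (simp add: b_def)
    qed (use mean in auto)
    define p where "p = (m - a) / (b - a)"
    have p: "0 \<le> p" "p \<le> 1" using am b by (auto simp: p_def)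
    obtain R where R: "prob_space R" "sets R = sets borel"
      "\<forall>f\<in>borel_measurable borel. (\<integral>\<^sup>+x. f x \<partial>R) =
        ennreal p * (\<integral>\<^sup>+x. f x \<partial>return borel b) + ennreal (1 - p) * (\<integral>\<^sup>+x. f x \<partial>return borel a)"
      by (rule mixture_measure[OF p ret(1,2)[OF meas(1), of b] ret(1,2)[OF meas(1), of a]])
    have "ereal a \<le> ereal m" "ereal m \<le> ereal b" using am b by auto
    from order_trans[OF this(1) mean(2)] order_trans[OF mean(1) this(2)]
     have range: "a \<in> demand_range P t" "b \<in> demand_range P t"
      using \<open>ereal b \<le> demand_upper P t\<close> a by (simp_all add: demand_range_def)
    have AE_R: "AE x in R. x \<in> demand_range P t"
      by (rule mixture_AE[OF ret(2)[OF meas(1)] ret(2)[OF meas(1)] R(2,3) demand_range_borel])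
        (simp_all only: ret(5)[OF meas(1)] range)
    have int: "integrable R f \<and> (\<integral>x. f x \<partial>R) = p * f b + (1 - p) * f a"
      if "f \<in> borel_measurable borel" for f :: "real \<Rightarrow> real"
      using mixture_integral[OF p ret(2)[OF that] ret(2)[OF that] R(2,3) ret(4)[OF that] ret(4)[OF that]]
      by (simp only: ret(3)[OF that] simp_thms)
    have "p * b + (1 - p) * a = a + p * (b - a)" by (simp add: algebra_simps)
    also have "\<dots> = m" using am b by (simp add: p_def)
    finally have mean_eq: "p * b + (1 - p) * a = m" .
    \<comment> \<open>Both atoms satisfy x^2 = (a + b) x - a b, so the second moment is determined
      by the mean.\<close>
    have "p * b\<^sup>2 + (1 - p) * a\<^sup>2 = (p * b + (1 - p) * a) * (a + b) - a * b"
      by (simp add: algebra_simps power2_eq_square)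
    also have "\<dots> = m\<^sup>2 + (m - a) * (b - m)"
      unfolding mean_eq by (simp add: algebra_simps power2_eq_square)
    also have "(m - a) * (b - m) = v" using am by (simp add: b_def)
    finally have "p * b\<^sup>2 + (1 - p) * a\<^sup>2 = m\<^sup>2 + v" .
    then have "R \<in> ambiguity_set P t"
      using AE_R R(1,2) int[OF meas(1)] int[OF meas(2)] mean_eq
      unfolding ambiguity_set_def m_def[symmetric] v_def[symmetric]
      by (simp add: \<open>p * b\<^sup>2 + (1 - p) * a\<^sup>2 = m\<^sup>2 + v\<close>)
    then show ?thesis by blast
  qed
qed

section \<open>Bounds on the expected one-period cost that depend on the distribution only through
  its first two moments\<close>

context
  fixes Q assumes Q: "Q \<in> ambiguity_set P t"
begin

interpretation prob_space Q by (rule ambiguity_setD(1)[OF Q])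

lemma integrable_adj_cost: "integrable Q (adj_cost P t x)"
  unfolding adj_cost_def using ambiguity_setD[OF Q]
  by (intro Bochner_Integration.integrable_add integrable_mult_right integrable_max
      Bochner_Integration.integrable_diff) auto

lemma convex_on_expected_adj_cost: "convex_on UNIV (expected_adj_cost t Q)"
proof (rule convex_onI)
  fix p x y :: real
  assume p: "0 < p" "p < 1"
  have "adj_cost P t ((1 - p) *\<^sub>R x + p *\<^sub>R y) d \<le> (1 - p) * adj_cost P t x d + p * adj_cost P t y d" for d
  proof -
    have mx: "max ((1 - p) * u + p * w) 0 \<le> (1 - p) * max u 0 + p * max w 0" for u w :: real
      using p by (smt (verit) max_def mult_nonneg_nonneg mult_nonneg_nonpos)
    have "max (d - ((1 - p) * x + p * y)) 0 \<le> (1 - p) * max (d - x) 0 + p * max (d - y) 0"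
      using mx[of "d - x" "d - y"] by (simp add: algebra_simps)
    moreover have "max ((1 - p) * x + p * y - d) 0 \<le> (1 - p) * max (x - d) 0 + p * max (y - d) 0"
      using mx[of "x - d" "y - d"] by (simp add: algebra_simps)
    ultimately have "backorder_cost P t * max (d - ((1 - p) * x + p * y)) 0
      \<le> backorder_cost P t * ((1 - p) * max (d - x) 0 + p * max (d - y) 0)"
      "holding_cost P t * max ((1 - p) * x + p * y - d) 0
      \<le> holding_cost P t * ((1 - p) * max (x - d) 0 + p * max (y - d) 0)"
      using costs by (auto intro!: mult_left_mono)
    then show ?thesis
      using t by (simp add: adj_cost_eq stage_cost_def) (simp add: algebra_simps)
  qed
  then have "expected_adj_cost t Q ((1 - p) *\<^sub>R x + p *\<^sub>R y)
      \<le> (\<integral>d. (1 - p) * adj_cost P t x d + p * adj_cost P t y d \<partial>Q)"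
    unfolding expected_adj_cost_def
    by (intro integral_mono integrable_adj_cost Bochner_Integration.integrable_add integrable_mult_right)
  also have "\<dots> = (1 - p) * expected_adj_cost t Q x + p * expected_adj_cost t Q y"
    unfolding expected_adj_cost_def
    by (simp add: Bochner_Integration.integral_add integrable_adj_cost)
  finally show "expected_adj_cost t Q ((1 - p) *\<^sub>R x + p *\<^sub>R y) \<le> \<dots>" .
qed auto

text \<open>Drops the holding cost and uses [d - x]_+ \<ge> d - x. As the slope in \<open>x\<close>
  is negative, it bounds sublevel sets from below.\<close>

lemma expected_adj_cost_ge_backorder:
  "(net_cost t - backorder_cost P t) * x + backorder_cost P t * demand_mean P t
    \<le> expected_adj_cost t Q x"
proof -
  have "(net_cost t - backorder_cost P t) * x + backorder_cost P t * d \<le> adj_cost P t x d" for d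
  proof -
    have "backorder_cost P t * (d - x) \<le> backorder_cost P t * max (d - x) 0"
      "0 \<le> holding_cost P t * max (x - d) 0"
      using costs by (auto intro!: mult_left_mono)
    then show ?thesis using t by (simp add: adj_cost_eq stage_cost_def algebra_simps)
  qed
  then have "(\<integral>d. (net_cost t - backorder_cost P t) * x + backorder_cost P t * d \<partial>Q)
      \<le> expected_adj_cost t Q x"
    unfolding expected_adj_cost_def using ambiguity_setD[OF Q]
    by (intro integral_mono integrable_adj_cost) auto
  then show ?thesis using ambiguity_setD[OF Q] by (simp add: prob_space)
qed

text \<open>Drops the backorder cost. It bounds sublevel sets from above if the slope is positive,
  and serves as a constant lower bound if the slope is zero.\<close>

lemma expected_adj_cost_ge_holding:
  "(net_cost t + holding_cost P t) * x - holding_cost P t * demand_mean P t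
    \<le> expected_adj_cost t Q x"
proof -
  have "(net_cost t + holding_cost P t) * x - holding_cost P t * d \<le> adj_cost P t x d" for d
  proof -
    have "holding_cost P t * (x - d) \<le> holding_cost P t * max (x - d) 0"
      "0 \<le> backorder_cost P t * max (d - x) 0"
      using costs by (auto intro!: mult_left_mono)
    then show ?thesis using t by (simp add: adj_cost_eq stage_cost_def algebra_simps)
  qed
  then have "(\<integral>d. (net_cost t + holding_cost P t) * x - holding_cost P t * d \<partial>Q)
      \<le> expected_adj_cost t Q x"
    unfolding expected_adj_cost_def using ambiguity_setD[OF Q]
    by (intro integral_mono integrable_adj_cost) auto
  then show ?thesis using ambiguity_setD[OF Q] by (simp add: prob_space)
qed

lemma expected_adj_cost_upper:
  "expected_adj_cost t Q x \<le>
    net_cost t * x + (backorder_cost P t + holding_cost P t) * (\<bar>x\<bar> + demand_mean P t)"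
proof -
  have "adj_cost P t x d \<le> net_cost t * x + (backorder_cost P t + holding_cost P t) * (\<bar>x\<bar> + d)"
    if "0 \<le> d" for d
  proof -
    have "backorder_cost P t * max (d - x) 0 \<le> backorder_cost P t * (\<bar>x\<bar> + d)"
      "holding_cost P t * max (x - d) 0 \<le> holding_cost P t * (\<bar>x\<bar> + d)"
      using costs that by (auto intro!: mult_left_mono)
    then show ?thesis using t by (simp add: adj_cost_eq stage_cost_def algebra_simps)
  qed
  then have "expected_adj_cost t Q x \<le>
      (\<integral>d. net_cost t * x + (backorder_cost P t + holding_cost P t) * (\<bar>x\<bar> + d) \<partial>Q)"
    unfolding expected_adj_cost_def using ambiguity_setD[OF Q]
    by (intro integral_mono_AE integrable_adj_cost) auto
  then show ?thesis using ambiguity_setD[OF Q] by (simp add: prob_space)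
qed

text \<open>For large \<open>x\<close> only the holding term matters, since \<open>[d - x]\<^sub>+ \<le> d\<^sup>2 / x\<close>.\<close>

lemma expected_adj_cost_tail:
  assumes x: "0 < x"
  shows "expected_adj_cost t Q x \<le>
    (net_cost t + holding_cost P t) * x - holding_cost P t * demand_mean P t +
    (backorder_cost P t + holding_cost P t) * (((demand_mean P t)\<^sup>2 + (demand_sd P t)\<^sup>2) / x)"
proof -
  have "adj_cost P t x d \<le> (net_cost t + holding_cost P t) * x - holding_cost P t * d +
      (backorder_cost P t + holding_cost P t) * (d\<^sup>2 / x)" if "0 \<le> d" for d
  proof -
    have "max (d - x) 0 \<le> d\<^sup>2 / x"
    proof (cases "d \<le> x")
      case False
      then have "d * x \<le> d * d" using that by (intro mult_left_mono) auto
      then have "d \<le> d\<^sup>2 / x" using x by (simp add: field_simps power2_eq_square)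
      with False x show ?thesis by auto
    qed (use x in auto)
    then have "(backorder_cost P t + holding_cost P t) * max (d - x) 0 \<le>
        (backorder_cost P t + holding_cost P t) * (d\<^sup>2 / x)"
      using costs by (intro mult_left_mono) auto
    moreover have "max (x - d) 0 = max (d - x) 0 + (x - d)" by auto
    then have "holding_cost P t * max (x - d) 0 =
        holding_cost P t * max (d - x) 0 + holding_cost P t * (x - d)"
      by (simp only: distrib_left)
    ultimately show ?thesis using t by (simp add: adj_cost_eq stage_cost_def algebra_simps)
  qed
  then have "expected_adj_cost t Q x \<le> (\<integral>d. (net_cost t + holding_cost P t) * x - holding_cost P t * d +
      (backorder_cost P t + holding_cost P t) * (d\<^sup>2 / x) \<partial>Q)"
    unfolding expected_adj_cost_def using ambiguity_setD[OF Q]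
    by (intro integral_mono_AE integrable_adj_cost) auto
  then show ?thesis using ambiguity_setD[OF Q] by (simp add: prob_space)
qed

end

section \<open>The one-period minimax value\<close>

lemma worst_adj_cost_eq: "worst_adj_cost P t x = (SUP Q\<in>ambiguity_set P t. ereal (expected_adj_cost t Q x))"
  unfolding worst_adj_cost_def expected_adj_cost_def
  by (intro SUP_cong refl ext_expectation_integrable integrable_adj_cost)

text \<open>An attained infimum is finite: any single distribution bounds the worst case from below,
  and \<open>expected_adj_cost_upper\<close> is uniform over the ambiguity set.\<close>

lemma eta_hat_real:
  assumes "x \<in> Gamma_hat P t"
  obtains e where "eta_hat P t = ereal e" "worst_adj_cost P t x = ereal e"
proof -
  have min: "worst_adj_cost P t x \<le> worst_adj_cost P t y" for y
    using assms by (auto simp: Gamma_hat_def is_arg_min_def not_less)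
  then have eq: "eta_hat P t = worst_adj_cost P t x"
    unfolding eta_hat_def by (intro antisym INF_lower INF_greatest) auto
  obtain Q where "Q \<in> ambiguity_set P t" using ambiguity_set_nonempty by blast
  then have "ereal (expected_adj_cost t Q x) \<le> worst_adj_cost P t x"
    unfolding worst_adj_cost_eq by (rule SUP_upper)
  moreover have "worst_adj_cost P t x \<le> ereal (net_cost t * x + (backorder_cost P t + holding_cost P t) * (\<bar>x\<bar> + demand_mean P t))"
    unfolding worst_adj_cost_eq by (intro SUP_least) (simp add: expected_adj_cost_upper)
  ultimately show ?thesis
    using that eq by (cases "worst_adj_cost P t x") auto
qed

text \<open>The exchange of infimum and supremum: \<open>Q\<close> is chosen before the level
  \<open>y\<close>, so \<open>y\<close> may later depend on past demands.\<close>

lemma eta_hat_approx: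
  assumes "x \<in> Gamma_hat P t" and c: "ereal c < eta_hat P t"
  shows "\<exists>Q\<in>ambiguity_set P t. \<forall>y. c \<le> expected_adj_cost t Q y"
proof -
  obtain e where e: "eta_hat P t = ereal e" using eta_hat_real[OF assms(1)] .
  have worst: "ereal e \<le> worst_adj_cost P t y" for y
    unfolding e[symmetric] eta_hat_def by (rule INF_lower) auto
  \<comment> \<open>Slope of the expected cost as the level tends to infinity, the same for all
    distributions; its sign decides whether sublevel sets are bounded.\<close>
  define k where "k = net_cost t + holding_cost P t"
  show ?thesis
  proof (cases "0 < k")
    case True
    show ?thesis
    proof (rule convex_minimax)
      show "bounded {y. expected_adj_cost t Q y \<le> c}" if Q: "Q \<in> ambiguity_set P t" for Q
      proof (rule bounded_subset)
        show "bounded {(c - backorder_cost P t * demand_mean P t) / (net_cost t - backorder_cost P t) ..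
            (c + holding_cost P t * demand_mean P t) / k}"
          by (rule bounded_closed_interval)
        show "{y. expected_adj_cost t Q y \<le> c} \<subseteq> \<dots>"
        proof clarsimp
          fix y assume "expected_adj_cost t Q y \<le> c"
          with expected_adj_cost_ge_backorder[OF Q, of y] expected_adj_cost_ge_holding[OF Q, of y]
          show "(c - backorder_cost P t * demand_mean P t) / (net_cost t - backorder_cost P t) \<le> y \<and>
              y \<le> (c + holding_cost P t * demand_mean P t) / k"
            using True net_cost_less by (simp add: k_def pos_le_divide_eq neg_divide_le_eq mult.commute)
        qed
      qed
      show "\<exists>r\<in>ambiguity_set P t. \<forall>x. expected_adj_cost t r x =
          p * expected_adj_cost t q x + (1 - p) * expected_adj_cost t q' x"
        if "q \<in> ambiguity_set P t" "q' \<in> ambiguity_set P t" "0 \<le> p" "p \<le> 1" for q q' p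
      proof -
        obtain R where "R \<in> ambiguity_set P t"
          "\<And>f :: real \<Rightarrow> real. integrable q f \<Longrightarrow> integrable q' f \<Longrightarrow>
            (\<integral>x. f x \<partial>R) = p * (\<integral>x. f x \<partial>q) + (1 - p) * (\<integral>x. f x \<partial>q')"
          using convex_ambiguity_set[OF \<open>q \<in> _\<close> \<open>q' \<in> _\<close> \<open>0 \<le> p\<close> \<open>p \<le> 1\<close>] by blast
        then show ?thesis
          using integrable_adj_cost that unfolding expected_adj_cost_def by (intro bexI[of _ R]) auto
      qed
      show "\<exists>Q\<in>ambiguity_set P t. c < expected_adj_cost t Q y" for y
        using less_le_trans[OF c[unfolded e] worst[of y]]
        by (simp add: worst_adj_cost_eq less_SUP_iff)
    qed (use ambiguity_set_nonempty convex_on_expected_adj_cost in auto)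
  next
    case False
    txt \<open>Here the sublevel sets may be unbounded; the tail estimate for \<open>y \<rightarrow> \<infinity>\<close> shows that every
      distribution will do.\<close>
    define C where "C = (backorder_cost P t + holding_cost P t) * ((demand_mean P t)\<^sup>2 + (demand_sd P t)\<^sup>2)"
    have "0 \<le> C" using costs by (auto simp: C_def)
    \<comment> \<open>The minimax value measured from the constant term of the asymptote k y - h_t
      mu_t.\<close>
    define e' where "e' = e + holding_cost P t * demand_mean P t"
    have tail: "e' \<le> k * y + C / y" if "0 < y" for y
    proof -
      have "worst_adj_cost P t y \<le> ereal (k * y - holding_cost P t * demand_mean P t + C / y)"
        unfolding worst_adj_cost_eq
        using expected_adj_cost_tail that by (intro SUP_least) (auto simp: k_def C_def)
      from order_trans[OF worst this] show ?thesis by (simp add: e'_def)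
    qed
    have "k = 0"
    proof (rule ccontr)
      assume "k \<noteq> 0"
      with False have k: "k < 0" by simp
      \<comment> \<open>Here k y = k - (|e'| + C), while C / y is at most \<open>C\<close>; the sum
        is thus smaller than e', against \<open>tail\<close>.\<close>
      define y where "y = 1 + (\<bar>e'\<bar> + C) / (- k)"
      have y: "1 \<le> y" using k \<open>0 \<le> C\<close> by (auto simp: y_def divide_nonneg_neg)
      have "C / y \<le> C / 1" using y \<open>0 \<le> C\<close> by (intro divide_left_mono) auto
      moreover have "k * y = k - (\<bar>e'\<bar> + C)" using k by (simp add: y_def field_simps)
      ultimately show False using tail[of y] y k by auto
    qed
    \<comment> \<open>With zero slope \<open>tail\<close> reads e' \<le> C / y for all y >
      0.\<close>
    have "e' \<le> 0"
    proof (rule ccontr)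
      assume "\<not> e' \<le> 0"
      with tail[of "(C + 1) / e'"] \<open>k = 0\<close> \<open>0 \<le> C\<close> show False
        by (auto simp: field_simps)
    qed
    obtain Q where Q: "Q \<in> ambiguity_set P t" using ambiguity_set_nonempty by blast
    have "c \<le> expected_adj_cost t Q y" for y
      using expected_adj_cost_ge_holding[OF Q, of y] \<open>k = 0\<close> \<open>e' \<le> 0\<close> c e by (simp add: k_def e'_def)
    with Q show ?thesis by blast
  qed
qed

end

subsection \<open>Dynamic programming and total costs\<close>

text \<open>Demands are almost surely nonnegative, so the next inventory level never exceeds
  \<open>x\<close>; a comparison below \<open>x\<close> suffices. This is where knowing a value
  function only at low levels becomes enough.\<close>

lemma dp_objective_mono:
  assumes t: "t \<in> {1..horizon P}" and F: "\<And>d. 0 \<le> d \<Longrightarrow> F (x - d) \<le> G (x - d)"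
  shows "dp_objective P F t y x \<le> dp_objective P G t y x"
  unfolding dp_objective_def
proof (intro add_left_mono SUP_subset_mono order_refl ext_expectation_mono_AE)
  fix Q assume "Q \<in> ambiguity_set P t"
  with ambiguity_setD(3)[OF t] have "AE d in Q. 0 \<le> d" by blast
  then show "AE d in Q. ereal (stage_cost P t x d) + ereal (discount P) * F (x - d) \<le>
      ereal (stage_cost P t x d) + ereal (discount P) * G (x - d)"
    by eventually_elim (use F discount in \<open>auto intro!: add_left_mono ereal_mult_left_mono\<close>)
qed

text \<open>A cost-to-go of slope -c_{t+1} turns the stage cost into \<open>adj_cost\<close>. The
  remaining terms are affine in the demand, have the same mean under every distribution of the
  ambiguity set, and so leave the supremum.\<close>

lemma dp_objective_affine:
  assumes t: "t \<in> {1..horizon P}"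
  shows "dp_objective P (\<lambda>z. ereal (k - unit_cost (t + 1) * z)) t y x =
    worst_adj_cost P t x +
    ereal (discount P * (unit_cost (t + 1) * demand_mean P t + k) - unit_cost t * y)"
proof -
  let ?k = "discount P * (unit_cost (t + 1) * demand_mean P t + k) - unit_cost t * x"
  have "ext_expectation Q (\<lambda>d. ereal (stage_cost P t x d) +
      ereal (discount P) * ereal (k - unit_cost (t + 1) * (x - d))) =
    ereal (expected_adj_cost t Q x) + ereal ?k" if Q: "Q \<in> ambiguity_set P t" for Q
  proof -
    interpret prob_space Q using ambiguity_setD(1)[OF t Q] .
    have eq: "stage_cost P t x d + discount P * (k - unit_cost (t + 1) * (x - d)) =
        adj_cost P t x d + (discount P * (unit_cost (t + 1) * d + k) - unit_cost t * x)" for d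
      using t by (simp add: adj_cost_eq net_cost_def algebra_simps)
    show ?thesis
      using integrable_adj_cost[OF t Q] ambiguity_setD(4,5)[OF t Q]
      by (simp add: eq[simplified] ext_expectation_integrable expected_adj_cost_def prob_space)
  qed
  then have "(SUP Q\<in>ambiguity_set P t. ext_expectation Q (\<lambda>d. ereal (stage_cost P t x d) +
      ereal (discount P) * ereal (k - unit_cost (t + 1) * (x - d)))) =
    (SUP Q\<in>ambiguity_set P t. ereal (expected_adj_cost t Q x) + ereal ?k)"
    by (intro SUP_cong refl)
  also have "\<dots> = worst_adj_cost P t x + ereal ?k"
    unfolding worst_adj_cost_eq[OF t] by (intro SUP_ereal_add_left ambiguity_set_nonempty t) simp
  finally have "(SUP Q\<in>ambiguity_set P t. ext_expectation Q (\<lambda>d. ereal (stage_cost P t x d) +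
      ereal (discount P) * ereal (k - unit_cost (t + 1) * (x - d)))) = worst_adj_cost P t x + ereal ?k" .
  \<comment> \<open>The ordering cost of \<open>x\<close> cancels against the last term of
    \<open>?k\<close>; only the credit for the initial level \<open>y\<close> is left.\<close>
  moreover have "ereal (order_cost P t * (x - y)) + (w + ereal ?k) =
      w + ereal (discount P * (unit_cost (t + 1) * demand_mean P t + k) - unit_cost t * y)" for w
    using t by (cases w) (auto simp: unit_cost_def algebra_simps)
  ultimately show ?thesis by (simp add: dp_objective_def)
qed

text \<open>Charging the replenishment of the leftover inventory \<open>y\<^sub>t\<^sub>+\<^sub>1 = x\<^sub>t - d\<^sub>t\<close> to period \<open>t\<close>
  decouples the periods.\<close>

lemma total_cost_eq:
  "total_cost P x d = (\<Sum>t=1..horizon P. discount P ^ (t - 1) *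
      (adj_cost P t (x t (restrict d {1..<t})) (d t) + discount P * unit_cost (t + 1) * d t))
    - order_cost P 1 * init_inv P"
proof -
  define X where "X t = x t (restrict d {1..<t})" for t
  define Y where "Y t = inv_level P x t d" for t
  define F where "F t = discount P ^ (t - 1) * (order_cost P t * (X t - Y t) + stage_cost P t (X t) (d t))" for t
  define G where "G t = discount P ^ (t - 1) * (adj_cost P t (X t) (d t) + discount P * unit_cost (t + 1) * d t)" for t
  have step: "F (Suc n) = G (Suc n) - discount P ^ n * unit_cost (Suc n) * Y (Suc n)
      + discount P ^ Suc n * unit_cost (Suc (Suc n)) * Y (Suc (Suc n))" if "Suc n \<le> horizon P" for n
  proof -
    have Y: "Y (Suc (Suc n)) = X (Suc n) - d (Suc n)"
      unfolding X_def Y_def by (rule inv_level_Suc) simp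
    show ?thesis
      unfolding Y using that by (simp add: F_def G_def adj_cost_eq net_cost_def unit_cost_def algebra_simps)
  qed
  have "(\<Sum>t=1..n. F t) =
    (\<Sum>t=1..n. G t) - unit_cost 1 * init_inv P + discount P ^ n * unit_cost (Suc n) * Y (Suc n)"
    if "n \<le> horizon P" for n
    using that
  proof (induction n)
    case 0
    show ?case using inv_level_1[of P x d] by (simp add: Y_def)
  next
    case (Suc n)
    then show ?case using step[of n] by simp
  qed
  from this[of "horizon P"] show ?thesis
    using horizon_pos by (simp add: total_cost_def unit_cost_def F_def G_def X_def Y_def)
qed

section \<open>Product distributions of the demand vector\<close>

lemma joint_ambiguity_setE:
  assumes "Q \<in> joint_ambiguity_set P"
  obtains q where "Q = Pi\<^sub>M {1..horizon P} q" "\<forall>t\<in>{1..horizon P}. q t \<in> ambiguity_set P t"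
  using assms by (auto simp: joint_ambiguity_set_def)

context
  fixes q :: "nat \<Rightarrow> real measure"
  assumes q: "\<forall>t\<in>{1..horizon P}. q t \<in> ambiguity_set P t"
begin

lemma prob_q: "t \<in> {1..horizon P} \<Longrightarrow> prob_space (q t)"
  using ambiguity_setD(1) q by blast

lemma sets_q: "t \<in> {1..horizon P} \<Longrightarrow> sets (q t) = sets borel"
  using ambiguity_setD(2) q by blast

lemma AE_demands_nonneg: "AE d in Pi\<^sub>M {1..horizon P} q. \<forall>t\<in>{1..horizon P}. 0 \<le> d t"
  using ambiguity_setD(3) q by (intro AE_finite_allI AE_PiM_component prob_q) auto

lemma measurable_demand: "t \<in> {1..horizon P} \<Longrightarrow> (\<lambda>d. d t) \<in> borel_measurable (Pi\<^sub>M {1..horizon P} q)"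
  using measurable_component_singleton[of t "{1..horizon P}" q] sets_q
  by (simp cong: measurable_cong_sets)

lemma component_integral:
  fixes f :: "real \<Rightarrow> real"
  assumes t: "t \<in> {1..horizon P}" and f: "integrable (q t) f"
  shows "integrable (Pi\<^sub>M {1..horizon P} q) (\<lambda>d. f (d t))"
    and "(\<integral>d. f (d t) \<partial>Pi\<^sub>M {1..horizon P} q) = (\<integral>x. f x \<partial>q t)"
proof -
  have distr: "distr (Pi\<^sub>M {1..horizon P} q) (q t) (\<lambda>d. d t) = q t"
    by (intro distr_PiM_component prob_q t)
  have m: "(\<lambda>d. d t) \<in> measurable (Pi\<^sub>M {1..horizon P} q) (q t)"
    using t by (rule measurable_component_singleton)
  show "integrable (Pi\<^sub>M {1..horizon P} q) (\<lambda>d. f (d t))"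
    by (rule integrable_distr[OF m, unfolded distr, OF f])
  show "(\<integral>d. f (d t) \<partial>Pi\<^sub>M {1..horizon P} q) = (\<integral>x. f x \<partial>q t)"
    by (rule integral_distr[OF m borel_measurable_integrable[OF f], unfolded distr, symmetric])
qed

end

text \<open>With the past frozen, the order-up-to level is a number, and every number costs at least
  \<open>k t\<close> in expectation. Adding up the periods requires integrability, hence the case
  split on infinite expected cost.\<close>

lemma ext_expectation_total_cost_ge:
  assumes q: "\<forall>t\<in>{1..horizon P}. q t \<in> ambiguity_set P t"
    and x: "x \<in> admissible P"
    and k: "\<And>t y. t \<in> {1..horizon P} \<Longrightarrow> k t \<le> expected_adj_cost t (q t) y"
  shows "ereal ((\<Sum>t=1..horizon P. discount P ^ (t - 1) *
      (k t + discount P * unit_cost (t + 1) * demand_mean P t)) - order_cost P 1 * init_inv P)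
    \<le> ext_expectation (Pi\<^sub>M {1..horizon P} q) (\<lambda>d. ereal (total_cost P x d))"
proof -
  let ?I = "{1..horizon P}" and ?Q = "Pi\<^sub>M {1..horizon P} q"
  interpret prob_space ?Q by (intro prob_space_PiM prob_q[OF q])
  txt \<open>Policies are measurable only on nonnegative histories, so demands are replaced by their
    positive parts, which changes nothing almost surely.\<close>
  define D where "D d = (\<lambda>i\<in>?I. max (d i) 0)" for d :: "nat \<Rightarrow> real"
  define X where "X t d = x t (restrict (D d) {1..<t})" for t d
  define Y where "Y t d = inv_level P x t (D d)" for t d
  define Z where "Z d = total_cost P x (D d)" for d
  have hist: "restrict (D d) {1..<t} = (\<lambda>i\<in>{1..<t}. max (d i) 0)" if "t \<in> ?I" for t d
    using that by (auto simp: D_def fun_eq_iff)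
  have D: "D d t = max (d t) 0" if "t \<in> ?I" for t d
    using that by (simp add: D_def)
  have mD: "(\<lambda>d. max (d t) 0) \<in> borel_measurable ?Q" if "t \<in> ?I" for t
    using measurable_demand[OF q that] by measurable
  have mX: "X t \<in> borel_measurable ?Q" if t: "t \<in> ?I" for t
  proof -
    have "(\<lambda>d. \<lambda>i\<in>{1..<t}. max (d i) 0) \<in> measurable ?Q (Pi\<^sub>M {1..<t} (\<lambda>_. restrict_space borel {0..}))"
      using t by (intro measurable_restrict measurable_restrict_space2 mD) auto
    moreover have "x t \<in> borel_measurable (Pi\<^sub>M {1..<t} (\<lambda>_. restrict_space borel {0..}))"
      using x t by (simp add: admissible_def)
    ultimately have "(\<lambda>d. x t (\<lambda>i\<in>{1..<t}. max (d i) 0)) \<in> borel_measurable ?Q"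
      by (rule measurable_compose)
    then show ?thesis by (simp only: X_def[abs_def] hist[OF t])
  qed
  have YX: "Y t d \<le> X t d" if t: "t \<in> ?I" for t d
  proof -
    have "restrict (D d) {1..<t} \<in> PiE {1..<t} (\<lambda>_. {0..})"
      unfolding hist[OF t] by auto
    then have "inv_level P x t (restrict (D d) {1..<t}) \<le> X t d"
      using x t by (auto simp: admissible_def X_def)
    then show ?thesis by (simp only: Y_def inv_level_restrict[OF order_refl])
  qed
  have Z_eq: "Z d = (\<Sum>t\<in>?I. discount P ^ (t - 1) *
      (adj_cost P t (X t d) (max (d t) 0) + discount P * unit_cost (t + 1) * max (d t) 0))
    - order_cost P 1 * init_inv P" for d
    unfolding Z_def total_cost_eq X_def by (intro arg_cong2[of _ _ _ _ minus] sum.cong refl) (simp add: D)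
  have term_nonneg: "0 \<le> discount P ^ (t - 1) * (order_cost P t * (X t d - Y t d) + stage_cost P t (X t d) (D d t))"
    if t: "t \<in> ?I" for t d
    using YX[OF t, of d] costs[OF t] stage_cost_nonneg[OF t] discount by simp
  have Z_nonneg: "0 \<le> Z d" for d
    unfolding Z_def total_cost_def X_def[symmetric] Y_def[symmetric] by (intro sum_nonneg term_nonneg)
  have order_le: "discount P ^ (t - 1) * order_cost P t * (X t d - Y t d) \<le> Z d" if t: "t \<in> ?I" for t d
  proof -
    have "discount P ^ (t - 1) * order_cost P t * (X t d - Y t d)
      \<le> discount P ^ (t - 1) * (order_cost P t * (X t d - Y t d) + stage_cost P t (X t d) (D d t))"
      using stage_cost_nonneg[OF t] discount by (simp add: algebra_simps)
    also have "\<dots> \<le> Z d"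
      unfolding Z_def total_cost_def X_def[symmetric] Y_def[symmetric]
      by (intro member_le_sum[where f = "\<lambda>t. discount P ^ (t - 1) *
            (order_cost P t * (X t d - Y t d) + stage_cost P t (X t d) (D d t))"] t term_nonneg) auto
    finally show ?thesis .
  qed
  \<comment> \<open>Read off the decoupled form, in which only order-up-to levels and demands
    occur.\<close>
  have mZ: "Z \<in> borel_measurable ?Q"
    unfolding Z_eq[abs_def] adj_cost_def
    by (intro borel_measurable_diff borel_measurable_sum borel_measurable_times borel_measurable_add
        borel_measurable_max borel_measurable_const mX mD)
  have "AE d in ?Q. ereal (total_cost P x d) = ereal (Z d)"
    using AE_demands_nonneg[OF q]
  proof eventually_elim
    case (elim d)
    then have "D d = restrict d ?I" by (auto simp: D_def fun_eq_iff)
    then show ?case by (simp only: Z_def total_cost_restrict)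
  qed
  then have ext: "ext_expectation ?Q (\<lambda>d. ereal (total_cost P x d)) = ext_expectation ?Q (\<lambda>d. ereal (Z d))"
    by (rule ext_expectation_cong_AE)
  show ?thesis
  proof (cases "(\<integral>\<^sup>+d. ennreal (Z d) \<partial>?Q) = \<infinity>")
    case True
    then have "ext_expectation ?Q (\<lambda>d. ereal (Z d)) = \<infinity>"
      using Z_nonneg by (simp add: ext_expectation_def ennreal_neg)
    then show ?thesis unfolding ext by simp
  next
    case False
    txt \<open>The terms of \<open>Z\<close> are nonnegative, so integrability of \<open>Z\<close> passes to the order-up-to levels
      one period after the other.\<close>
    then have intZ: "integrable ?Q Z"
      using mZ Z_nonneg by (intro integrableI_nonneg) (auto simp: less_top)
    have int_d: "integrable ?Q (\<lambda>d. max (d t) 0)"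
      and mean_d: "(\<integral>d. max (d t) 0 \<partial>?Q) = demand_mean P t" if t: "t \<in> ?I" for t
    proof -
      note Qt = ambiguity_setD[OF t q[rule_format, OF t]]
      have "integrable (q t) (\<lambda>x. max x 0)" using Qt(4) by (intro integrable_max) auto
      note * = component_integral[OF q t this]
      show "integrable ?Q (\<lambda>d. max (d t) 0)" using *(1) by simp
      have "(\<integral>x. max x 0 \<partial>q t) = (\<integral>x. x \<partial>q t)"
      proof (rule integral_cong_AE)
        show "AE x in q t. max x 0 = x" using Qt(3) by eventually_elim simp
      qed (use \<open>integrable (q t) (\<lambda>x. max x 0)\<close> Qt(4) in \<open>simp_all only: borel_measurable_integrable\<close>)
      with *(2) Qt(5) show "(\<integral>d. max (d t) 0 \<partial>?Q) = demand_mean P t" by simp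
    qed
    have intX: "integrable ?Q (X t)" if t: "t \<in> ?I" and Y: "integrable ?Q (Y t)" for t
    proof -
      \<comment> \<open>\<open>order_le\<close> bounds the order quantity by \<open>Z d / a\<close>;
        with the inventory level integrable, so is the order-up-to level.\<close>
      define a where "a = discount P ^ (t - 1) * order_cost P t"
      have a: "0 < a" using costs[OF t] discount by (simp add: a_def)
      have "integrable ?Q (\<lambda>d. X t d - Y t d)"
      proof (rule Bochner_Integration.integrable_bound)
        show "integrable ?Q (\<lambda>d. Z d / a)" using intZ by simp
        show "(\<lambda>d. X t d - Y t d) \<in> borel_measurable ?Q"
          using mX[OF t] Y by auto
        show "AE d in ?Q. norm (X t d - Y t d) \<le> norm (Z d / a)"
          using order_le[OF t, folded a_def] YX[OF t] a Z_nonneg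
          by (intro AE_I2) (simp add: pos_le_divide_eq mult.commute)
      qed
      from Bochner_Integration.integrable_add[OF this Y] show ?thesis by simp
    qed
    have int: "integrable ?Q (X t)" if "t \<in> ?I" for t
    proof -
      have "1 \<le> t" "t \<le> horizon P" using that by auto
      then show ?thesis
      proof (induction t rule: dec_induct)
        case base
        have "Y 1 = (\<lambda>_. init_inv P)" by (simp only: Y_def[abs_def] inv_level_1)
        then have "integrable ?Q (Y 1)" by (simp only: integrable_const)
        then show ?case using base by (intro intX) auto
      next
        case (step n)
        then have n: "n \<in> ?I" by auto
        with step have "Y (Suc n) = (\<lambda>d. X n d - max (d n) 0)"
          by (simp add: Y_def[abs_def] inv_level_Suc X_def D)
        moreover have "integrable ?Q (X n)" using step by simp
        ultimately have "integrable ?Q (Y (Suc n))"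
          using int_d[OF n] by (simp only: Bochner_Integration.integrable_diff)
        then show ?case using step by (intro intX) auto
      qed
    qed
    have int_adj: "integrable ?Q (\<lambda>d. adj_cost P t (X t d) (max (d t) 0))" if "t \<in> ?I" for t
    proof -
      note * = int[OF that] int_d[OF that]
      have "integrable ?Q (\<lambda>d. max (max (d t) 0 - X t d) 0)"
        by (rule integrable_max[OF Bochner_Integration.integrable_diff[OF *(2,1)] integrable_zero])
      moreover have "integrable ?Q (\<lambda>d. max (X t d - max (d t) 0) 0)"
        by (rule integrable_max[OF Bochner_Integration.integrable_diff[OF *] integrable_zero])
      ultimately show ?thesis
        unfolding adj_cost_def using *(1)
        by (intro Bochner_Integration.integrable_add integrable_mult_right)
    qed
    have ge: "k t \<le> (\<integral>d. adj_cost P t (X t d) (max (d t) 0) \<partial>?Q)" if t: "t \<in> ?I" for t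
    proof -
      note Qt = ambiguity_setD[OF t q[rule_format, OF t]]
      have I: "insert t (?I - {t}) = ?I" using t by auto
      have "k t \<le> (\<integral>d. adj_cost P t (X t d) (max (d t) 0) \<partial>Pi\<^sub>M (insert t (?I - {t})) q)"
      proof (rule PiM_integral_ge)
        show "integrable (Pi\<^sub>M (insert t (?I - {t})) q) (\<lambda>d. adj_cost P t (X t d) (max (d t) 0))"
          unfolding I by (rule int_adj[OF t])
        fix d :: "nat \<Rightarrow> real"
        \<comment> \<open>The level of period \<open>t\<close> reads only demands before
          \<open>t\<close>, so varying coordinate \<open>t\<close> leaves it unchanged. This is the
          independence of level and demand.\<close>
        have "(\<lambda>i\<in>{1..<t}. max ((d(t := y)) i) 0) = (\<lambda>i\<in>{1..<t}. max (d i) 0)" for y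
          by (rule restrict_ext) simp
        then have "X t (d(t := y)) = X t d" for y
          by (simp only: X_def hist[OF t])
        then have "(\<integral>y. adj_cost P t (X t (d(t := y))) (max ((d(t := y)) t) 0) \<partial>q t) =
            (\<integral>y. adj_cost P t (X t d) (max y 0) \<partial>q t)" by simp
        also have "\<dots> = expected_adj_cost t (q t) (X t d)"
          unfolding expected_adj_cost_def
        proof (rule integral_cong_AE)
          show m: "adj_cost P t z \<in> borel_measurable (q t)" for z
            by (rule borel_measurable_integrable[OF integrable_adj_cost[OF t q[rule_format, OF t]]])
          have "(\<lambda>y. max y 0) \<in> measurable (q t) (q t)"
            unfolding measurable_cong_sets[OF refl Qt(2)]
            by (intro borel_measurable_max borel_measurable_integrable[OF Qt(4)] borel_measurable_const)
          from measurable_compose[OF this m]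
          show "(\<lambda>y. adj_cost P t (X t d) (max y 0)) \<in> borel_measurable (q t)" .
          show "AE y in q t. adj_cost P t (X t d) (max y 0) = adj_cost P t (X t d) y"
            using Qt(3) by eventually_elim simp
        qed
        finally show "k t \<le> (\<integral>y. adj_cost P t (X t (d(t := y))) (max ((d(t := y)) t) 0) \<partial>q t)"
          using k[OF t] by simp
      qed (use prob_q[OF q] t in blast)+
      then show ?thesis unfolding I .
    qed
    have "(\<Sum>t\<in>?I. discount P ^ (t - 1) * (k t + discount P * unit_cost (t + 1) * demand_mean P t)) - order_cost P 1 * init_inv P
      \<le> (\<Sum>t\<in>?I. discount P ^ (t - 1) * ((\<integral>d. adj_cost P t (X t d) (max (d t) 0) \<partial>?Q) +
          discount P * unit_cost (t + 1) * demand_mean P t)) - order_cost P 1 * init_inv P"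
      using ge discount by (intro diff_right_mono sum_mono mult_left_mono add_right_mono) auto
    also have "\<dots> = (\<integral>d. Z d \<partial>?Q)"
    proof -
      define g where "g t d = discount P ^ (t - 1) *
          (adj_cost P t (X t d) (max (d t) 0) + discount P * unit_cost (t + 1) * max (d t) 0)" for t d
      have int_g: "integrable ?Q (g t)" and mean_g: "(\<integral>d. g t d \<partial>?Q) = discount P ^ (t - 1) *
          ((\<integral>d. adj_cost P t (X t d) (max (d t) 0) \<partial>?Q) + discount P * unit_cost (t + 1) * demand_mean P t)"
        if "t \<in> ?I" for t
        unfolding g_def[abs_def] using int_adj[OF that] int_d[OF that] mean_d[OF that] by simp_all
      have int_sum: "integrable ?Q (\<lambda>d. \<Sum>t\<in>?I. g t d)"
        using int_g by (rule Bochner_Integration.integrable_sum)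
      have "(\<integral>d. Z d \<partial>?Q) = (\<integral>d. (\<Sum>t\<in>?I. g t d) - order_cost P 1 * init_inv P \<partial>?Q)"
        by (simp only: Z_eq g_def)
      also have "\<dots> = (\<Sum>t\<in>?I. \<integral>d. g t d \<partial>?Q) - order_cost P 1 * init_inv P"
      proof -
        have "(\<integral>d. (\<Sum>t\<in>?I. g t d) \<partial>?Q) = (\<Sum>t\<in>?I. \<integral>d. g t d \<partial>?Q)"
          using int_g by (rule Bochner_Integration.integral_sum)
        then show ?thesis
          unfolding Bochner_Integration.integral_diff[OF int_sum integrable_const]
          by (simp only: lebesgue_integral_const prob_space scaleR_one)
      qed
      finally show ?thesis using mean_g by simp
    qed
    finally show ?thesis unfolding ext ext_expectation_integrable[OF intZ] by simp
  qed
qed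

end

subsection \<open>Optimality of the base-stock policy\<close>

locale base_stock = inventory +
  fixes s :: "nat \<Rightarrow> real"
  assumes s_mono: "\<And>t. t \<in> {1..<horizon P} \<Longrightarrow> s t \<le> s (t + 1)"
    and init_le: "init_inv P \<le> s 1"
    and s_Gamma_hat: "\<And>t. t \<in> {1..horizon P} \<Longrightarrow> s t \<in> Gamma_hat P t"
begin

text \<open>The conversion loses nothing, since \<open>eta_hat\<close> is finite within the
  horizon.\<close>

definition eta :: "nat \<Rightarrow> real" where
  "eta t = real_of_ereal (eta_hat P t)"

text \<open>The intercept K_t of the affine bound for the value function. Each period contributes
  its minimax value and the discounted purchase of its mean demand in the next period.\<close>

definition cost_to_go :: "nat \<Rightarrow> real" where
  "cost_to_go t = (\<Sum>k=t..horizon P. discount P ^ (k - t) *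
     (eta k + discount P * unit_cost (k + 1) * demand_mean P k))"

lemma eta: "t \<in> {1..horizon P} \<Longrightarrow> eta_hat P t = ereal (eta t)"
  and worst_adj_cost_s: "t \<in> {1..horizon P} \<Longrightarrow> worst_adj_cost P t (s t) = ereal (eta t)"
  using eta_hat_real[OF _ s_Gamma_hat] by (metis eta_def real_of_ereal.simps(1))+

lemma eta_le_worst: "t \<in> {1..horizon P} \<Longrightarrow> ereal (eta t) \<le> worst_adj_cost P t x"
  unfolding eta[symmetric] eta_hat_def by (rule INF_lower) auto

lemma expected_adj_cost_s_le:
  "t \<in> {1..horizon P} \<Longrightarrow> Q \<in> ambiguity_set P t \<Longrightarrow> expected_adj_cost t Q (s t) \<le> eta t"
  using worst_adj_cost_s[of t] SUP_upper[of Q "ambiguity_set P t" "\<lambda>Q. ereal (expected_adj_cost t Q (s t))"]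
  by (simp add: worst_adj_cost_eq)

lemma cost_to_go_end: "cost_to_go (Suc (horizon P)) = 0"
  by (simp add: cost_to_go_def)

lemma cost_to_go_step:
  assumes "t \<le> horizon P"
  shows "cost_to_go t = eta t + discount P * (unit_cost (t + 1) * demand_mean P t + cost_to_go (t + 1))"
proof -
  have "cost_to_go t = eta t + discount P * unit_cost (t + 1) * demand_mean P t +
    (\<Sum>k=Suc t..horizon P. discount P ^ (k - t) *
     (eta k + discount P * unit_cost (k + 1) * demand_mean P k))"
    unfolding cost_to_go_def using assms by (subst sum.atLeast_Suc_atMost) auto
  also have "(\<Sum>k=Suc t..horizon P. discount P ^ (k - t) *
     (eta k + discount P * unit_cost (k + 1) * demand_mean P k)) = discount P * cost_to_go (t + 1)"
    unfolding cost_to_go_def sum_distrib_left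
  proof (rule sum.cong)
    fix k assume "k \<in> {t + 1..horizon P}"
    then have "k - t = Suc (k - (t + 1))" by auto
    then show "discount P ^ (k - t) * (eta k + discount P * unit_cost (k + 1) * demand_mean P k) =
      discount P * (discount P ^ (k - (t + 1)) * (eta k + discount P * unit_cost (k + 1) * demand_mean P k))"
      by simp
  qed simp
  finally show ?thesis by (simp add: algebra_simps)
qed

text \<open>An affine lower bound of slope -c_{t+1} reproduces itself one period earlier with slope
  -c_t, because \<open>worst_adj_cost\<close> is at least \<open>eta t\<close> at every
  level.\<close>

lemma dp_objective_ge:
  assumes t: "t \<in> {1..horizon P}" and F: "\<And>z. ereal (cost_to_go (t + 1) - unit_cost (t + 1) * z) \<le> F z"
  shows "ereal (cost_to_go t - unit_cost t * y) \<le> dp_objective P F t y x"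
proof -
  have "ereal (cost_to_go t - unit_cost t * y) = ereal (eta t) +
      ereal (discount P * (unit_cost (t + 1) * demand_mean P t + cost_to_go (t + 1)) - unit_cost t * y)"
    using t by (simp add: cost_to_go_step[of t])
  also have "\<dots> \<le> dp_objective P (\<lambda>z. ereal (cost_to_go (t + 1) - unit_cost (t + 1) * z)) t y x"
    unfolding dp_objective_affine[OF t] by (intro add_right_mono eta_le_worst t)
  also have "\<dots> \<le> dp_objective P F t y x"
    by (intro dp_objective_mono t F)
  finally show ?thesis .
qed

text \<open>From \<open>s t\<close>, nonnegative demand leads to a level below s_{t+1}, where
  \<open>F\<close> is affine. In the last period there is no s_{t+1}, so the formula is asked for at
  all levels. With \<open>F\<close> left open, both \<open>dp_value\<close> and
  \<open>dp_rule_value\<close> are covered.\<close>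

lemma dp_objective_base_stock:
  assumes t: "t \<in> {1..horizon P}"
    and F: "\<And>z. (t + 1 \<le> horizon P \<Longrightarrow> z \<le> s (t + 1)) \<Longrightarrow>
      F z = ereal (cost_to_go (t + 1) - unit_cost (t + 1) * z)"
  shows "dp_objective P F t y (s t) = ereal (cost_to_go t - unit_cost t * y)"
proof -
  have "F (s t - d) = ereal (cost_to_go (t + 1) - unit_cost (t + 1) * (s t - d))" if "0 \<le> d" for d
    using that s_mono[of t] t by (intro F) auto
  then have "dp_objective P F t y (s t) =
      dp_objective P (\<lambda>z. ereal (cost_to_go (t + 1) - unit_cost (t + 1) * z)) t y (s t)"
    by (intro antisym dp_objective_mono[OF t]) auto
  also have "\<dots> = ereal (cost_to_go t - unit_cost t * y)"
    unfolding dp_objective_affine[OF t] using t by (simp add: worst_adj_cost_s cost_to_go_step[of t])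
  finally show ?thesis .
qed

lemma dp_value_ge:
  assumes "1 \<le> t" "t \<le> Suc (horizon P)"
  shows "ereal (cost_to_go t - unit_cost t * y) \<le> dp_value P t y"
  using assms(2,1)
proof (induction t arbitrary: y rule: inc_induct)
  case base
  show ?case by (simp add: cost_to_go_end unit_cost_def dp_value.simps)
next
  case (step t)
  then have "dp_value P t y = (INF x\<in>{y..}. dp_objective P (dp_value P (t + 1)) t y x)"
    by (subst dp_value.simps) simp
  moreover have "ereal (cost_to_go t - unit_cost t * y) \<le> dp_objective P (dp_value P (t + 1)) t y x" for x
    using step by (intro dp_objective_ge) auto
  ultimately show ?case by (auto intro: INF_greatest)
qed

lemma dp_value_eq:
  assumes "1 \<le> t" "t \<le> Suc (horizon P)" "t \<le> horizon P \<Longrightarrow> y \<le> s t"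
  shows "dp_value P t y = ereal (cost_to_go t - unit_cost t * y)"
  using assms(2,1,3)
proof (induction t arbitrary: y rule: inc_induct)
  case base
  show ?case by (simp add: cost_to_go_end unit_cost_def dp_value.simps)
next
  case (step t)
  then have "dp_value P t y \<le> dp_objective P (dp_value P (t + 1)) t y (s t)"
    by (subst dp_value.simps) (auto intro!: INF_lower)
  also have "\<dots> = ereal (cost_to_go t - unit_cost t * y)"
    using step by (intro dp_objective_base_stock) auto
  finally show ?case
    using step dp_value_ge[of t y] by (intro antisym) auto
qed

lemma dp_rule_value_eq:
  assumes "1 \<le> t" "t \<le> Suc (horizon P)" "t \<le> horizon P \<Longrightarrow> y \<le> s t"
  shows "dp_rule_value P (base_stock_rule s) t y = ereal (cost_to_go t - unit_cost t * y)"
  using assms(2,1,3)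
proof (induction t arbitrary: y rule: inc_induct)
  case base
  show ?case by (simp add: cost_to_go_end unit_cost_def dp_rule_value.simps)
next
  case (step t)
  then have "dp_rule_value P (base_stock_rule s) t y =
      dp_objective P (dp_rule_value P (base_stock_rule s) (t + 1)) t y (s t)"
    by (subst dp_rule_value.simps) (auto simp: base_stock_rule_def max_def)
  also have "\<dots> = ereal (cost_to_go t - unit_cost t * y)"
    using step by (intro dp_objective_base_stock) auto
  finally show ?case .
qed

lemma s_dp_minimizer:
  assumes t: "t \<in> {1..horizon P}" and y: "y \<le> s t"
  shows "s t \<in> dp_minimizers P t y"
proof -
  have "dp_objective P (dp_value P (t + 1)) t y (s t) \<le> dp_objective P (dp_value P (t + 1)) t y x" for x
    using t dp_objective_base_stock[OF t, of "dp_value P (t + 1)"] dp_objective_ge[OF t, of "dp_value P (t + 1)" y x]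
      dp_value_eq[of "t + 1"] dp_value_ge[of "t + 1"] by auto
  then show ?thesis using y by (auto simp: dp_minimizers_def is_arg_min_def not_less)
qed

section \<open>The base-stock policy along demand paths\<close>

lemma base_stock_levels:
  assumes d: "\<forall>t\<in>{1..horizon P}. 0 \<le> d t" and t: "1 \<le> t" "t \<le> horizon P"
  shows "inv_level P (base_stock_policy P s) t d \<le> s t"
    and "base_stock_policy P s t (restrict d {1..<t}) = s t"
proof -
  have level: "base_stock_policy P s t (restrict d {1..<t}) = max (inv_level P (base_stock_policy P s) t d) (s t)" for t
    unfolding base_stock_policy_def rule_policy_inv_level by (simp add: base_stock_rule_def)
  show le: "inv_level P (base_stock_policy P s) t d \<le> s t"
    using t
  proof (induction t rule: dec_induct)
    case base
    show ?case using init_le inv_level_1 by simp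
  next
    case (step n)
    then have "inv_level P (base_stock_policy P s) (Suc n) d = s n - d n"
      using level[of n] by (simp add: inv_level_Suc)
    also have "\<dots> \<le> s (Suc n)" using step d s_mono[of n] by (auto intro: add_increasing2 simp: diff_le_eq)
    finally show ?case .
  qed
  show "base_stock_policy P s t (restrict d {1..<t}) = s t"
    using le level[of t] by simp
qed

lemma measurable_base_stock_policy:
  "base_stock_policy P s t \<in> borel_measurable (Pi\<^sub>M {1..<t} (\<lambda>_. restrict_space borel {0..}))"
proof (induction t rule: less_induct)
  case (less t)
  show ?case
  proof (cases "t \<le> 1")
    case True
    then have "base_stock_policy P s t = (\<lambda>_. max (init_inv P) (s t))"
      by (auto simp: base_stock_policy_def fun_eq_iff base_stock_rule_def rule_policy.simps[of P _ t])
    then show ?thesis by simp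
  next
    case False
    then have eq: "base_stock_policy P s t =
        (\<lambda>d. max (base_stock_policy P s (t - 1) (restrict d {1..<t - 1}) - d (t - 1)) (s t))"
      by (auto simp: base_stock_policy_def fun_eq_iff base_stock_rule_def rule_policy.simps[of P _ t])
    have [measurable]: "(\<lambda>d. restrict d {1..<t - 1}) \<in>
        measurable (Pi\<^sub>M {1..<t} (\<lambda>_. restrict_space borel {0..})) (Pi\<^sub>M {1..<t - 1} (\<lambda>_. restrict_space borel {0..}))"
      by (rule measurable_restrict_subset) auto
    have [measurable]: "(\<lambda>d. d (t - 1)) \<in> borel_measurable (Pi\<^sub>M {1..<t} (\<lambda>_. restrict_space borel {0..}))"
      by (rule measurable_compose[OF measurable_component_singleton, of "t - 1"])
        (use False in \<open>auto intro: measurable_restrict_space1\<close>)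
    have [measurable]: "base_stock_policy P s (t - 1) \<in> borel_measurable (Pi\<^sub>M {1..<t - 1} (\<lambda>_. restrict_space borel {0..}))"
      using False by (intro less) auto
    show ?thesis unfolding eq by measurable
  qed
qed

lemma admissible_base_stock_policy: "base_stock_policy P s \<in> admissible P"
proof -
  have "inv_level P (base_stock_policy P s) t d \<le> base_stock_policy P s t d"
    if "d \<in> PiE {1..<t} (\<lambda>_. {0..})" for t d
  proof -
    \<comment> \<open>Histories are extensional, so the identity for restricted paths applies to
      them directly.\<close>
    have "restrict d {1..<t} = d" using that by (rule PiE_restrict)
    with rule_policy_inv_level[of P "base_stock_rule s" t d] show ?thesis
      by (simp add: base_stock_policy_def base_stock_rule_def)
  qed
  then show ?thesis using measurable_base_stock_policy by (simp add: admissible_def)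
qed

section \<open>The multistage-static value\<close>

definition opt_value :: real where
  "opt_value = cost_to_go 1 - order_cost P 1 * init_inv P"

lemma opt_value_sum:
  "opt_value = (\<Sum>t=1..horizon P. discount P ^ (t - 1) *
     (eta t + discount P * unit_cost (t + 1) * demand_mean P t)) - order_cost P 1 * init_inv P"
  by (simp add: opt_value_def cost_to_go_def)

text \<open>Almost surely the levels are the constants \<open>s t\<close>, so the cost is a sum of
  functions of single demands and only the marginals matter.\<close>

lemma static_value_base_stock_le: "static_value P (base_stock_policy P s) \<le> ereal opt_value"
  unfolding static_value_def
proof (rule SUP_least)
  fix Q assume "Q \<in> joint_ambiguity_set P"
  then obtain q where Q: "Q = Pi\<^sub>M {1..horizon P} q"
    and q: "\<forall>t\<in>{1..horizon P}. q t \<in> ambiguity_set P t"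
    using joint_ambiguity_setE by blast
  interpret prob_space Q unfolding Q by (intro prob_space_PiM prob_q[OF q])
  note comp = component_integral[OF q, folded Q]
  define g where "g t d = discount P ^ (t - 1) * (adj_cost P t (s t) d + discount P * unit_cost (t + 1) * d)" for t d
  let ?f = "\<lambda>d. (\<Sum>t=1..horizon P. g t (d t)) - order_cost P 1 * init_inv P"
  have int: "integrable Q (\<lambda>d. g t (d t))"
    and val: "(\<integral>d. g t (d t) \<partial>Q) =
      discount P ^ (t - 1) * (expected_adj_cost t (q t) (s t) + discount P * unit_cost (t + 1) * demand_mean P t)"
    if t: "t \<in> {1..horizon P}" for t
    unfolding g_def
    using comp[OF t integrable_adj_cost[OF t q[rule_format, OF t]]]
      comp[OF t ambiguity_setD(4)[OF t q[rule_format, OF t]]] ambiguity_setD(5)[OF t q[rule_format, OF t]]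
    by (simp_all add: expected_adj_cost_def)
  have int_sum: "integrable Q (\<lambda>d. \<Sum>t=1..horizon P. g t (d t))"
    using int by (rule Bochner_Integration.integrable_sum)
  have "AE d in Q. ereal (total_cost P (base_stock_policy P s) d) = ereal (?f d)"
    using AE_demands_nonneg[OF q, folded Q]
  proof eventually_elim
    case (elim d)
    have "(\<Sum>t=1..horizon P. discount P ^ (t - 1) *
        (adj_cost P t (base_stock_policy P s t (restrict d {1..<t})) (d t) + discount P * unit_cost (t + 1) * d t)) =
      (\<Sum>t=1..horizon P. g t (d t))"
      using base_stock_levels(2)[OF elim] by (intro sum.cong) (simp_all add: g_def)
    then show ?case by (simp add: total_cost_eq)
  qed
  then have "ext_expectation Q (\<lambda>d. ereal (total_cost P (base_stock_policy P s) d)) =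
      ext_expectation Q (\<lambda>d. ereal (?f d))"
    by (rule ext_expectation_cong_AE)
  also have "\<dots> = ereal (\<integral>d. ?f d \<partial>Q)"
    using int_sum by (intro ext_expectation_integrable Bochner_Integration.integrable_diff) auto
  also have "(\<integral>d. ?f d \<partial>Q) = (\<Sum>t=1..horizon P. \<integral>d. g t (d t) \<partial>Q) - order_cost P 1 * init_inv P"
    using int int_sum by (simp add: prob_space)
  also have "\<dots> = (\<Sum>t=1..horizon P. discount P ^ (t - 1) *
      (expected_adj_cost t (q t) (s t) + discount P * unit_cost (t + 1) * demand_mean P t)) - order_cost P 1 * init_inv P"
    using val by simp
  also have "\<dots> \<le> opt_value"
    unfolding opt_value_sum using discount expected_adj_cost_s_le q[rule_format]
    by (intro diff_right_mono sum_mono mult_left_mono add_right_mono) auto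
  finally show "ext_expectation Q (\<lambda>d. ereal (total_cost P (base_stock_policy P s) d)) \<le> ereal opt_value" by simp
qed

lemma static_value_ge:
  assumes x: "x \<in> admissible P"
  shows "ereal opt_value \<le> static_value P x"
proof (rule ereal_le_epsilon2)
  fix e :: real assume e: "0 < e"
  \<comment> \<open>Total weight of the periods: a slack of \<open>e / N\<close> per period adds up
    to exactly \<open>e\<close> after discounting.\<close>
  define N where "N = (\<Sum>t=1..horizon P. discount P ^ (t - 1))"
  have N: "0 < N"
    unfolding N_def using discount horizon_pos by (intro sum_pos) auto
  have "\<exists>Q\<in>ambiguity_set P t. \<forall>y. eta t - e / N \<le> expected_adj_cost t Q y" if t: "t \<in> {1..horizon P}" for t
    using e N by (intro eta_hat_approx[OF t s_Gamma_hat[OF t]]) (simp add: eta[OF t])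
  then obtain q where q: "\<And>t. t \<in> {1..horizon P} \<Longrightarrow> q t \<in> ambiguity_set P t"
    "\<And>t y. t \<in> {1..horizon P} \<Longrightarrow> eta t - e / N \<le> expected_adj_cost t (q t) y"
    by metis
  have "opt_value - e = (\<Sum>t=1..horizon P. discount P ^ (t - 1) *
    ((eta t - e / N) + discount P * unit_cost (t + 1) * demand_mean P t)) - order_cost P 1 * init_inv P"
  proof -
    have "(\<Sum>t=1..horizon P. discount P ^ (t - 1) *
        ((eta t - e / N) + discount P * unit_cost (t + 1) * demand_mean P t)) =
      (\<Sum>t=1..horizon P. discount P ^ (t - 1) * (eta t + discount P * unit_cost (t + 1) * demand_mean P t)
        - discount P ^ (t - 1) * (e / N))"
      by (intro sum.cong refl) (simp add: algebra_simps)
    also have "\<dots> = (\<Sum>t=1..horizon P. discount P ^ (t - 1) *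
        (eta t + discount P * unit_cost (t + 1) * demand_mean P t)) - N * (e / N)"
      unfolding N_def sum_distrib_right by (rule sum_subtractf)
    finally show ?thesis using N by (simp add: opt_value_sum)
  qed
  also have "ereal \<dots> \<le> ext_expectation (Pi\<^sub>M {1..horizon P} q) (\<lambda>d. ereal (total_cost P x d))"
    using q(1) by (intro ext_expectation_total_cost_ge[OF _ x q(2)]) auto
  also have "\<dots> \<le> static_value P x"
    unfolding static_value_def using q(1) by (intro SUP_upper) (auto simp: joint_ambiguity_set_def)
  finally have "ereal (opt_value - e) + ereal e \<le> static_value P x + ereal e"
    by (rule add_right_mono)
  then show "ereal opt_value \<le> static_value P x + ereal e" by simp
qed

lemma static_value_base_stock: "static_value P (base_stock_policy P s) = ereal opt_value"
  by (intro antisym static_value_base_stock_le static_value_ge admissible_base_stock_policy)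

lemma static_optimal_base_stock: "static_optimal P (base_stock_policy P s)"
  unfolding static_optimal_def static_value_base_stock
  using admissible_base_stock_policy static_value_base_stock static_value_ge
  by (auto intro!: antisym INF_greatest intro: INF_lower2)

lemma robust_wp1_optimal_base_stock: "robust_wp1_optimal P (base_stock_policy P s)"
  unfolding robust_wp1_optimal_def
proof (intro conjI ballI admissible_base_stock_policy)
  fix Q assume "Q \<in> joint_ambiguity_set P"
  then obtain q where Q: "Q = Pi\<^sub>M {1..horizon P} q"
    and q: "\<forall>t\<in>{1..horizon P}. q t \<in> ambiguity_set P t"
    using joint_ambiguity_setE by blast
  show "AE d in Q. \<forall>t\<in>{1..horizon P}. base_stock_policy P s t (restrict d {1..<t}) \<in>
      dp_minimizers P t (inv_level P (base_stock_policy P s) t d)"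
    using AE_demands_nonneg[OF q, folded Q]
  proof eventually_elim
    case (elim d)
    show ?case
    proof
      fix t assume t: "t \<in> {1..horizon P}"
      then have "1 \<le> t" "t \<le> horizon P" by auto
      note base_stock_levels[OF elim this]
      with s_dp_minimizer[OF t] show "base_stock_policy P s t (restrict d {1..<t}) \<in>
        dp_minimizers P t (inv_level P (base_stock_policy P s) t d)" by simp
    qed
  qed
qed

lemma opt_value_eta_hat:
  "ereal opt_value = (\<Sum>t=1..horizon P. ereal (discount P ^ (t - 1)) * eta_hat P t)
     - ereal (order_cost P 1 * init_inv P)
     + ereal (\<Sum>t=1..<horizon P. discount P ^ t * order_cost P (t + 1) * demand_mean P t)"
proof -
  have "(\<Sum>t=1..horizon P. ereal (discount P ^ (t - 1)) * eta_hat P t) =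
      ereal (\<Sum>t=1..horizon P. discount P ^ (t - 1) * eta t)"
    unfolding sum_ereal[symmetric] by (intro sum.cong refl) (simp add: eta)
  \<comment> \<open>The last summand vanishes because \<open>unit_cost\<close> is zero beyond the
    horizon.\<close>
  moreover have "(\<Sum>t=1..horizon P. discount P ^ (t - 1) * (discount P * unit_cost (t + 1) * demand_mean P t)) =
      (\<Sum>t=1..<horizon P. discount P ^ t * order_cost P (t + 1) * demand_mean P t)"
  proof (rule sum.mono_neutral_cong_right)
    fix t assume "t \<in> {1..<horizon P}"
    then have "discount P ^ t = discount P ^ (t - 1) * discount P" "unit_cost (t + 1) = order_cost P (t + 1)"
      by (auto simp: power_eq_if unit_cost_def)
    then show "discount P ^ (t - 1) * (discount P * unit_cost (t + 1) * demand_mean P t) =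
      discount P ^ t * order_cost P (t + 1) * demand_mean P t" by simp
  qed (auto simp: unit_cost_def)
  ultimately show ?thesis
    by (simp add: opt_value_sum distrib_left sum.distrib)
qed

end

theorem theorem3:
  fixes P :: inventory_model and s :: "nat \<Rightarrow> real" and v :: ereal
  assumes "valid_model P"
    and "\<And>t. t \<in> {1..horizon P} \<Longrightarrow> demand_range P t \<subseteq> {0..}"
    and "\<And>t. t \<in> {1..<horizon P} \<Longrightarrow> s t \<le> s (t + 1)"
    and "init_inv P \<le> s 1"
    and "\<And>t. t \<in> {1..horizon P} \<Longrightarrow> s t \<in> Gamma_hat P t"
    and "v = (\<Sum>t=1..horizon P. ereal (discount P ^ (t - 1)) * eta_hat P t)
             - ereal (order_cost P 1 * init_inv P)
             + ereal (\<Sum>t=1..<horizon P. discount P ^ t * order_cost P (t + 1) * demand_mean P t)"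
  shows "static_optimal P (base_stock_policy P s)
       \<and> robust_wp1_optimal P (base_stock_policy P s)
       \<and> static_value P (base_stock_policy P s) = v
       \<and> dp_rule_value P (base_stock_rule s) 1 (init_inv P) = v
       \<and> dp_value P 1 (init_inv P) = v
       \<and> time_consistent P (base_stock_policy P s)
       \<and> weakly_time_consistent P"
proof -
  interpret base_stock P s
    by unfold_locales (use assms(1-5) in blast)+
  have v: "v = ereal opt_value" by (simp only: assms(6) opt_value_eta_hat)
  have v': "v = ereal (cost_to_go 1 - unit_cost 1 * init_inv P)"
    using horizon_pos by (simp add: v opt_value_def unit_cost_def)
  have "dp_rule_value P (base_stock_rule s) 1 (init_inv P) = v"
    unfolding v' by (rule dp_rule_value_eq) (use init_le in auto)
  moreover have "dp_value P 1 (init_inv P) = v"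
    unfolding v' by (rule dp_value_eq) (use init_le in auto)
  ultimately show ?thesis
    using static_optimal_base_stock robust_wp1_optimal_base_stock static_value_base_stock v
    unfolding time_consistent_def weakly_time_consistent_def by auto
qed

end
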